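(* Let $(G,c,r)$ be a connected, locally finite weighted graph with $G=(\mathcal{V},\mathcal{E})$, and let $D=\mathrm{d}+\delta$ be its Gauss-Bonnet operator on $\mathcal{C}_0(\mathcal{V})\oplus\mathcal{C}^a_0(\mathcal{E})$. Let $W$ be a Hilbert space satisfying: (1) $\mathcal{C}_{0}(\mathcal{V})\oplus\mathcal{C}^{a}_{0}(\mathcal{E})$ is dense in $W$; (2) the injection of $\mathcal{C}_{0}(\mathcal{V})\oplus\mathcal{C}^{a}_{0}(\mathcal{E})$ into $\mathcal{C}(\mathcal{V})\oplus\mathcal{C}^{a}(\mathcal{E})$ extends by continuity to $W$; (3) $D:W\to l^{2}(G)$ is a bounded operator. Then the following conditions are equivalent: (i) $D:W\to l^{2}(G)$ is semi-Fredholm; (ii) there exist a finite subgraph $G_K=(K,\mathcal{E}_K)$ of $G$ and a constant $C=C_K>0$ such that $$C\,\|(f,\varphi)\|_{W}\le \|D(f,\varphi)\|_{l^{2}(G)}\qquad\text{for all }(f,\varphi)\in\mathcal{C}_{0}(\mathcal{V}\setminus K)\times\mathcal{C}^{a}_{0}(\mathcal{E}\setminus\mathcal{E}_{K}).$$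
   Context: A graph $G=(\mathcal{V},\mathcal{E})$ consists of an at most countable set $\mathcal{V}$ of vertices and a set $\mathcal{E}\subset\mathcal{V}\times\mathcal{V}$ of oriented edges which is symmetric ($(x,y)\in\mathcal{E}\Rightarrow(y,x)\in\mathcal{E}$) and has no loops. For $e=(x,y)$ write $e^-=x$, $e^+=y$, $-e=(y,x)$. $G$ is locally finite if each vertex is the origin of finitely many edges. A weighted graph $(G,c,r)$ has weights $c:\mathcal{V}\to(0,\infty)$ and $r:\mathcal{E}\to(0,\infty)$ with $r(-e)=r(e)$. For $K\subset\mathcal{V}$, the subgraph $G_K=(K,\mathcal{E}_K)$ has $\mathcal{E}_K=\{e\in\mathcal{E}: e^-,e^+\in K\}$; it is finite if $K$ is finite. $\mathcal{C}(\mathcal{V})$ is the space of functions $f:\mathcal{V}\to\mathbb{R}$; $\mathcal{C}^a(\mathcal{E})$ is the space of functions $\varphi:\mathcal{E}\to\mathbb{R}$ with $\varphi(-e)=-\varphi(e)$; $\mathcal{C}(\mathcal{V})\oplus\mathcal{C}^a(\mathcal{E})$ carries the topology of pointwise convergence. $\mathcal{C}_0(\mathcal{V})$ and $\mathcal{C}^a_0(\mathcal{E})$ are the subspaces of finitely supported functions; $\mathcal{C}_0(\mathcal{V}\setminus K)$ and $\mathcal{C}^a_0(\mathcal{E}\setminus\mathcal{E}_K)$ denote those with support in $\mathcal{V}\setminus K$, resp. $\mathcal{E}\setminus\mathcal{E}_K$. $l^2(\mathcal{V})$ has norm $\|f\|^2_{l^2(\mathcal V)}=\sum_{x\in\mathcal{V}}c(x)f(x)^2$,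 $l^2(\mathcal{E})\subset \mathcal{C}^a(\mathcal{E})$ has norm $\|\varphi\|^2_{l^2(\mathcal E)}=\frac12\sum_{e\in\mathcal{E}}r(e)\varphi(e)^2$, and $l^2(G)=l^2(\mathcal{V})\oplus l^2(\mathcal{E})$ with $\|(f,\varphi)\|^2_{l^2(G)}=\|f\|^2_{l^2(\mathcal V)}+\|\varphi\|^2_{l^2(\mathcal E)}$. $\mathrm{d}f(e)=f(e^+)-f(e^-)$ and $\delta\varphi(x)=\frac{1}{c(x)}\sum_{e:\,e^+=x}r(e)\varphi(e)$. The Gauss-Bonnet operator is $D(f,\varphi)=(\delta\varphi,\mathrm{d}f)$ on $\mathcal{C}_0(\mathcal{V})\oplus\mathcal{C}^a_0(\mathcal{E})$; in (3) and (i), $D$ on $W$ is its bounded extension from the dense subspace $\mathcal{C}_0(\mathcal{V})\oplus\mathcal{C}^a_0(\mathcal{E})$. An operator is called semi-Fredholm if its range is closed and its kernel is finite dimensional.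
   Formalization: In (2) the continuous extension of the injection to W is required to be injective as well, so that W is a space of functions; without this, (i) does not imply (ii) in general. *)

theory Defs
  imports
    "HOL-Analysis.Analysis"
    "HOL-Library.Function_Algebras"
    "Graph_Theory.Digraph_Component"
    "Graph_Theory.Pair_Digraph"
begin

text \<open>The library provides addition and subtraction of functions (\<^theory>\<open>HOL-Library.Function_Algebras\<close>)
  and the topology of pointwise convergence (\<^theory>\<open>HOL-Analysis.Function_Topology\<close>),
  but not scalar multiplication.\<close>

instantiation "fun" :: (type, real_vector) real_vector
begin

definition scaleR_fun :: "real \<Rightarrow> ('a \<Rightarrow> 'b) \<Rightarrow> 'a \<Rightarrow> 'b" where
  "scaleR_fun a f = (\<lambda>x. a *\<^sub>R f x)"

instance
  by standard (auto simp: scaleR_fun_def fun_eq_iff scaleR_add_right scaleR_add_left)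

end

lemma scaleR_fun_apply [simp]: "(a *\<^sub>R f) x = a *\<^sub>R f x"
  by (simp add: scaleR_fun_def)


section \<open>Weighted graphs\<close>

text \<open>The oriented edge \<open>e\<close> is the pair \<open>(e\<^sup>-, e\<^sup>+)\<close>, so that \<open>e\<^sup>- = fst e\<close>,
  \<open>e\<^sup>+ = snd e\<close> and \<open>-e = prod.swap e\<close>.\<close>

locale weighted_graph = pair_bidirected_digraph G for G :: "'v pair_pre_digraph" +
  fixes c :: "'v \<Rightarrow> real" and r :: "'v \<times> 'v \<Rightarrow> real"
  assumes countable_verts: "countable (pverts G)"
    and c_pos: "x \<in> pverts G \<Longrightarrow> c x > 0"
    and r_pos: "e \<in> parcs G \<Longrightarrow> r e > 0"
    and r_swap: "e \<in> parcs G \<Longrightarrow> r (prod.swap e) = r e"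

definition locally_finite :: "'v pair_pre_digraph \<Rightarrow> bool" where
  "locally_finite G \<longleftrightarrow> (\<forall>x\<in>pverts G. finite {e \<in> parcs G. fst e = x})"


section \<open>Functions on vertices and edges\<close>

text \<open>A function on the vertices (or on the edges) is represented by its extension by zero to the
  whole type; the topology of pointwise convergence is then the one of the function type.\<close>

type_synonym 'v cochain = "('v \<Rightarrow> real) \<times> ('v \<times> 'v \<Rightarrow> real)"

definition vfuns :: "'v pair_pre_digraph \<Rightarrow> ('v \<Rightarrow> real) set" where
  "vfuns G = {f. \<forall>x. x \<notin> pverts G \<longrightarrow> f x = 0}"

definition efuns :: "'v pair_pre_digraph \<Rightarrow> ('v \<times> 'v \<Rightarrow> real) set" where
  "efuns G = {\<phi>. (\<forall>e. e \<notin> parcs G \<longrightarrow> \<phi> e = 0) \<and> (\<forall>e\<in>parcs G. \<phi> (prod.swap e) = - \<phi> e)}"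

definition vfuns0 :: "'v pair_pre_digraph \<Rightarrow> 'v set \<Rightarrow> ('v \<Rightarrow> real) set" where
  "vfuns0 G A = {f \<in> vfuns G. finite {x. f x \<noteq> 0} \<and> {x. f x \<noteq> 0} \<subseteq> A}"

definition efuns0 :: "'v pair_pre_digraph \<Rightarrow> ('v \<times> 'v) set \<Rightarrow> ('v \<times> 'v \<Rightarrow> real) set" where
  "efuns0 G A = {\<phi> \<in> efuns G. finite {e. \<phi> e \<noteq> 0} \<and> {e. \<phi> e \<noteq> 0} \<subseteq> A}"

definition cochains :: "'v pair_pre_digraph \<Rightarrow> 'v cochain set" where
  "cochains G = vfuns G \<times> efuns G"

definition cochains0 :: "'v pair_pre_digraph \<Rightarrow> 'v cochain set" where
  "cochains0 G = vfuns0 G (pverts G) \<times> efuns0 G (parcs G)"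


section \<open>The Hilbert space \<open>l\<^sup>2(G)\<close>\<close>

definition l2V :: "'v pair_pre_digraph \<Rightarrow> ('v \<Rightarrow> real) \<Rightarrow> ('v \<Rightarrow> real) set" where
  "l2V G c = {f \<in> vfuns G. (\<lambda>x. c x * (f x)\<^sup>2) summable_on pverts G}"

definition l2V_norm :: "'v pair_pre_digraph \<Rightarrow> ('v \<Rightarrow> real) \<Rightarrow> ('v \<Rightarrow> real) \<Rightarrow> real" where
  "l2V_norm G c f = sqrt (\<Sum>\<^sub>\<infinity>x\<in>pverts G. c x * (f x)\<^sup>2)"

definition l2E :: "'v pair_pre_digraph \<Rightarrow> ('v \<times> 'v \<Rightarrow> real) \<Rightarrow> ('v \<times> 'v \<Rightarrow> real) set" where
  "l2E G r = {\<phi> \<in> efuns G. (\<lambda>e. r e * (\<phi> e)\<^sup>2) summable_on parcs G}"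

definition l2E_norm :: "'v pair_pre_digraph \<Rightarrow> ('v \<times> 'v \<Rightarrow> real) \<Rightarrow> ('v \<times> 'v \<Rightarrow> real) \<Rightarrow> real" where
  "l2E_norm G r \<phi> = sqrt (1/2 * (\<Sum>\<^sub>\<infinity>e\<in>parcs G. r e * (\<phi> e)\<^sup>2))"

definition l2 ::
  "'v pair_pre_digraph \<Rightarrow> ('v \<Rightarrow> real) \<Rightarrow> ('v \<times> 'v \<Rightarrow> real) \<Rightarrow> 'v cochain set" where
  "l2 G c r = l2V G c \<times> l2E G r"

definition l2_norm ::
  "'v pair_pre_digraph \<Rightarrow> ('v \<Rightarrow> real) \<Rightarrow> ('v \<times> 'v \<Rightarrow> real) \<Rightarrow> 'v cochain \<Rightarrow> real" where
  "l2_norm G c r u = sqrt ((l2V_norm G c (fst u))\<^sup>2 + (l2E_norm G r (snd u))\<^sup>2)"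

definition l2_dist ::
  "'v pair_pre_digraph \<Rightarrow> ('v \<Rightarrow> real) \<Rightarrow> ('v \<times> 'v \<Rightarrow> real) \<Rightarrow> 'v cochain \<Rightarrow> 'v cochain \<Rightarrow> real" where
  "l2_dist G c r u v = l2_norm G c r (u - v)"

definition l2_topology ::
  "'v pair_pre_digraph \<Rightarrow> ('v \<Rightarrow> real) \<Rightarrow> ('v \<times> 'v \<Rightarrow> real) \<Rightarrow> 'v cochain topology" where
  "l2_topology G c r = Metric_space.mtopology (l2 G c r) (l2_dist G c r)"

lemma weighted_l2_add:
  fixes w f g :: "'a \<Rightarrow> real"
  assumes w: "\<And>x. x \<in> A \<Longrightarrow> w x \<ge> 0"
    and f: "(\<lambda>x. w x * (f x)\<^sup>2) summable_on A"
    and g: "(\<lambda>x. w x * (g x)\<^sup>2) summable_on A"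
  shows "(\<lambda>x. w x * (f x + g x)\<^sup>2) summable_on A" (is ?summable)
    and "sqrt (\<Sum>\<^sub>\<infinity>x\<in>A. w x * (f x + g x)\<^sup>2)
      \<le> sqrt (\<Sum>\<^sub>\<infinity>x\<in>A. w x * (f x)\<^sup>2) + sqrt (\<Sum>\<^sub>\<infinity>x\<in>A. w x * (g x)\<^sup>2)" (is ?triangle)
proof -
  define a where "a = sqrt (\<Sum>\<^sub>\<infinity>x\<in>A. w x * (f x)\<^sup>2)"
  define b where "b = sqrt (\<Sum>\<^sub>\<infinity>x\<in>A. w x * (g x)\<^sup>2)"
  have nonneg: "a \<ge> 0" "b \<ge> 0"
    unfolding a_def b_def using w by (auto intro!: infsum_nonneg)
  have fin: "(\<Sum>x\<in>F. w x * (f x + g x)\<^sup>2) \<le> (a + b)\<^sup>2" if F: "finite F" "F \<subseteq> A" for F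
  proof -
    have eq: "sqrt (\<Sum>x\<in>F. w x * (h x)\<^sup>2) = L2_set (\<lambda>x. sqrt (w x) * h x) F" for h :: "'a \<Rightarrow> real"
      unfolding L2_set_def using F w
      by (intro arg_cong[where f = sqrt] sum.cong) (auto simp: power_mult_distrib subset_iff)
    have "sqrt (\<Sum>x\<in>F. w x * (f x + g x)\<^sup>2)
        \<le> sqrt (\<Sum>x\<in>F. w x * (f x)\<^sup>2) + sqrt (\<Sum>x\<in>F. w x * (g x)\<^sup>2)"
      unfolding eq distrib_left by (rule L2_set_triangle_ineq)
    also have "\<dots> \<le> a + b"
      unfolding a_def b_def using F w f g
      by (intro add_mono real_sqrt_le_mono finite_sum_le_infsum) auto
    finally have "sqrt (\<Sum>x\<in>F. w x * (f x + g x)\<^sup>2) \<le> a + b" .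
    then show ?thesis
      using sqrt_le_D by blast
  qed
  show ?summable
    by (rule nonneg_bdd_above_summable_on) (use w fin in \<open>auto simp: bdd_above_def\<close>)
  then have "(\<Sum>\<^sub>\<infinity>x\<in>A. w x * (f x + g x)\<^sup>2) \<le> (a + b)\<^sup>2"
    using fin by (rule infsum_le_finite_sums)
  then have "sqrt (\<Sum>\<^sub>\<infinity>x\<in>A. w x * (f x + g x)\<^sup>2) \<le> a + b"
    using nonneg by (intro real_le_lsqrt) auto
  then show ?triangle
    by (simp add: a_def b_def)
qed

context weighted_graph
begin

lemma l2V_norm_eq_0:
  assumes "f \<in> l2V G c" "l2V_norm G c f = 0"
  shows "f = 0"
proof
  fix x
  have "c x * (f x)\<^sup>2 = 0" if "x \<in> pverts G"
    using assms that c_pos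
    by (intro nonneg_infsum_le_0D[where A = "pverts G" and f = "\<lambda>x. c x * (f x)\<^sup>2"])
      (auto simp: l2V_def l2V_norm_def less_imp_le)
  with c_pos[of x] assms(1) show "f x = 0 x"
    by (cases "x \<in> pverts G") (auto simp: l2V_def vfuns_def)
qed

lemma l2E_norm_eq_0:
  assumes "\<phi> \<in> l2E G r" "l2E_norm G r \<phi> = 0"
  shows "\<phi> = 0"
proof
  fix e
  have "r e * (\<phi> e)\<^sup>2 = 0" if "e \<in> parcs G"
    using assms that r_pos
    by (intro nonneg_infsum_le_0D[where A = "parcs G" and f = "\<lambda>e. r e * (\<phi> e)\<^sup>2"])
      (auto simp: l2E_def l2E_norm_def less_imp_le)
  with r_pos[of e] assms(1) show "\<phi> e = 0 e"
    by (cases "e \<in> parcs G") (simp_all add: l2E_def efuns_def del: split_paired_All)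
qed

lemma l2_minus: "u \<in> l2 G c r \<Longrightarrow> - u \<in> l2 G c r"
  by (auto simp: l2_def l2V_def l2E_def vfuns_def efuns_def)

lemma l2_norm_minus: "l2_norm G c r (- u) = l2_norm G c r u"
  by (simp add: l2_norm_def l2V_norm_def l2E_norm_def)

lemma l2_add:
  assumes "u \<in> l2 G c r" "v \<in> l2 G c r"
  shows "u + v \<in> l2 G c r"
  using assms c_pos r_pos
  by (auto simp: l2_def l2V_def l2E_def vfuns_def efuns_def less_imp_le intro!: weighted_l2_add(1))

lemma l2_norm_triangle:
  assumes "u \<in> l2 G c r" "v \<in> l2 G c r"
  shows "l2_norm G c r (u + v) \<le> l2_norm G c r u + l2_norm G c r v"
proof -
  let ?n = "\<lambda>u. (l2V_norm G c (fst u), l2E_norm G r (snd u))"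
  have norm: "l2_norm G c r u = norm (?n u)" for u
    by (simp add: l2_norm_def norm_Pair)
  have nonneg: "l2V_norm G c f \<ge> 0" "l2E_norm G r \<phi> \<ge> 0" for f \<phi>
    using c_pos r_pos by (auto simp: l2V_norm_def l2E_norm_def less_imp_le intro!: infsum_nonneg)
  have V: "l2V_norm G c (fst u + fst v) \<le> l2V_norm G c (fst u) + l2V_norm G c (fst v)"
    using assms c_pos unfolding l2V_norm_def plus_fun_def
    by (intro weighted_l2_add(2)) (auto simp: l2_def l2V_def less_imp_le)
  have "sqrt (\<Sum>\<^sub>\<infinity>e\<in>parcs G. r e * ((snd u + snd v) e)\<^sup>2)
      \<le> sqrt (\<Sum>\<^sub>\<infinity>e\<in>parcs G. r e * (snd u e)\<^sup>2) + sqrt (\<Sum>\<^sub>\<infinity>e\<in>parcs G. r e * (snd v e)\<^sup>2)"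
    using assms r_pos unfolding plus_fun_def
    by (intro weighted_l2_add(2)) (auto simp: l2_def l2E_def less_imp_le)
  then have E: "l2E_norm G r (snd u + snd v) \<le> l2E_norm G r (snd u) + l2E_norm G r (snd v)"
    unfolding l2E_norm_def real_sqrt_mult distrib_left[symmetric]
    by (intro mult_left_mono) auto
  have "l2_norm G c r (u + v) \<le> norm (?n u + ?n v)"
    using V E nonneg by (simp add: l2_norm_def norm_Pair add_mono power_mono)
  also have "\<dots> \<le> l2_norm G c r u + l2_norm G c r v"
    unfolding norm by (rule norm_triangle_ineq)
  finally show ?thesis .
qed

lemma Metric_space_l2: "Metric_space (l2 G c r) (l2_dist G c r)"
proof
  fix u v w
  show "l2_dist G c r u v \<ge> 0"
    by (simp add: l2_dist_def l2_norm_def)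
  show "l2_dist G c r u v = l2_dist G c r v u"
    using l2_norm_minus[of "u - v"] by (simp add: l2_dist_def)
  assume u: "u \<in> l2 G c r" and v: "v \<in> l2 G c r"
  have diff: "u - v \<in> l2 G c r" if "u \<in> l2 G c r" "v \<in> l2 G c r" for u v
    using l2_add[OF that(1) l2_minus[OF that(2)]] by simp
  show "l2_dist G c r u v = 0 \<longleftrightarrow> u = v"
  proof
    assume "l2_dist G c r u v = 0"
    then have "l2V_norm G c (fst (u - v)) = 0" "l2E_norm G r (snd (u - v)) = 0"
      by (simp_all add: l2_dist_def l2_norm_def sum_power2_eq_zero_iff)
    moreover have "fst (u - v) \<in> l2V G c" "snd (u - v) \<in> l2E G r"
      using diff[OF u v] unfolding l2_def mem_Times_iff by blast+
    ultimately have "fst (u - v) = 0" "snd (u - v) = 0"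
      by (blast intro: l2V_norm_eq_0 l2E_norm_eq_0)+
    then show "u = v"
      by (simp add: prod_eq_iff)
  qed (simp add: l2_dist_def l2_norm_def l2V_norm_def l2E_norm_def)
  assume w: "w \<in> l2 G c r"
  show "l2_dist G c r u w \<le> l2_dist G c r u v + l2_dist G c r v w"
    using l2_norm_triangle[OF diff[OF u v] diff[OF v w]] by (simp add: l2_dist_def)
qed

end


section \<open>The Gauss-Bonnet operator\<close>

definition exterior_d :: "'v pair_pre_digraph \<Rightarrow> ('v \<Rightarrow> real) \<Rightarrow> ('v \<times> 'v \<Rightarrow> real)" where
  "exterior_d G f = (\<lambda>e. if e \<in> parcs G then f (snd e) - f (fst e) else 0)"

definition codifferential ::
  "'v pair_pre_digraph \<Rightarrow> ('v \<Rightarrow> real) \<Rightarrow> ('v \<times> 'v \<Rightarrow> real) \<Rightarrow> ('v \<times> 'v \<Rightarrow> real) \<Rightarrow> ('v \<Rightarrow> real)" where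
  "codifferential G c r \<phi> = (\<lambda>x. if x \<in> pverts G
     then 1 / c x * (\<Sum>e | e \<in> parcs G \<and> snd e = x. r e * \<phi> e) else 0)"

definition gauss_bonnet ::
  "'v pair_pre_digraph \<Rightarrow> ('v \<Rightarrow> real) \<Rightarrow> ('v \<times> 'v \<Rightarrow> real) \<Rightarrow> 'v cochain \<Rightarrow> 'v cochain" where
  "gauss_bonnet G c r u = (codifferential G c r (snd u), exterior_d G (fst u))"


section \<open>The Hilbert space \<open>W\<close>\<close>

text \<open>The Hilbert space \<open>W\<close> is a type \<open>'w :: {real_inner, complete_space}\<close>; the map \<open>\<iota>\<close>, of which
  only the restriction to \<open>cochains0 G\<close> matters, identifies the finitely supported
  cochains with elements of \<open>W\<close>.\<close>

definition dense_subspace_via ::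
  "'v pair_pre_digraph \<Rightarrow> ('v cochain \<Rightarrow> 'w::real_normed_vector) \<Rightarrow> bool" where
  "dense_subspace_via G \<iota> \<longleftrightarrow>
     (\<forall>u\<in>cochains0 G. \<forall>v\<in>cochains0 G. \<iota> (u + v) = \<iota> u + \<iota> v) \<and>
     (\<forall>a. \<forall>u\<in>cochains0 G. \<iota> (a *\<^sub>R u) = a *\<^sub>R \<iota> u) \<and>
     inj_on \<iota> (cochains0 G) \<and>
     closure (\<iota> ` cochains0 G) = UNIV"

text \<open>The extension \<open>j\<close> is required to be again an injection, so that \<open>W\<close> is a space of pairs of
  functions. This is not automatic: a sequence of finitely supported cochains that is Cauchy in
  the norm of \<open>W\<close> and tends to 0 pointwise need not tend to 0 in \<open>W\<close>. Linearity of \<open>j\<close> need not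
  be required, as it follows from continuity and density.\<close>

definition injection_extends ::
  "'v pair_pre_digraph \<Rightarrow> ('v cochain \<Rightarrow> 'w::real_normed_vector) \<Rightarrow> bool" where
  "injection_extends G \<iota> \<longleftrightarrow>
     (\<exists>j :: 'w \<Rightarrow> 'v cochain. continuous_on UNIV j \<and> inj j \<and> range j \<subseteq> cochains G \<and>
        (\<forall>u\<in>cochains0 G. j (\<iota> u) = u))"

text \<open>Since \<open>cochains0 G\<close> is dense in \<open>W\<close>, a bounded extension \<open>T\<close> of \<open>D\<close> to \<open>W\<close> is unique, and
  one exists if and only if \<open>D\<close> is bounded on \<open>cochains0 G\<close> for the norm of \<open>W\<close>.\<close>

definition bounded_extension ::
  "'v pair_pre_digraph \<Rightarrow> ('v \<Rightarrow> real) \<Rightarrow> ('v \<times> 'v \<Rightarrow> real) \<Rightarrow>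
    ('v cochain \<Rightarrow> 'w::real_normed_vector) \<Rightarrow> ('w \<Rightarrow> 'v cochain) \<Rightarrow> bool" where
  "bounded_extension G c r \<iota> T \<longleftrightarrow>
     linear T \<and> range T \<subseteq> l2 G c r \<and> (\<exists>M. \<forall>w. l2_norm G c r (T w) \<le> M * norm w) \<and>
     (\<forall>u\<in>cochains0 G. T (\<iota> u) = gauss_bonnet G c r u)"

definition semi_fredholm :: "'b topology \<Rightarrow> ('a::real_vector \<Rightarrow> 'b::zero) \<Rightarrow> bool" where
  "semi_fredholm X T \<longleftrightarrow>
     closedin X (range T) \<and> (\<exists>B. finite B \<and> span B = {w. T w = 0})"

end

theory Submission
  imports Defs
begin

text \<open>
  Write \<open>T\<close> for the extension of the Gauss-Bonnet operator to \<open>W\<close> and view elements of \<open>W\<close> as cochains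
  through \<open>j\<close>. Every coordinate of \<open>j w\<close>, the value at a vertex or at an edge, is a bounded linear
  functional of \<open>w\<close>, and the coordinates separate the points of \<open>W\<close>. Both implications rest on the fact
  that a finite-dimensional subspace of \<open>W\<close> is recovered linearly from finitely many coordinates
  (\<open>coordinates_of_separating\<close>).

  If \<open>T\<close> is semi-Fredholm, then its range is complete, because \<open>l\<^sup>2(G)\<close> is (\<open>l2_mcomplete\<close>), so the open
  mapping theorem provides preimages of controlled norm (\<open>bounded_preimage\<close>). The kernel is determined by
  its values on a finite subgraph. A cochain \<open>u\<close> that vanishes there differs from a controlled preimage
  \<open>w\<close> of \<open>T u\<close> by a kernel element whose values on that subgraph are those of \<open>- w\<close>, and which is
  therefore controlled by \<open>w\<close> (\<open>bound_away_of_semi_fredholm\<close>).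

  Conversely, \<open>W\<close> is the sum of the closure \<open>S\<close> of the cochains away from \<open>K\<close> and of the
  finite-dimensional space of cochains on \<open>G\<^sub>K\<close>. The estimate extends to \<open>S\<close>, so \<open>T\<close> maps \<open>S\<close> injectively
  onto a closed space. Adding finitely many dimensions keeps the range closed (\<open>closedin_add_span\<close>) and
  leaves only finitely many for the kernel (\<open>semi_fredholm_of_bound_away\<close>).
\<close>

section \<open>Normed subspaces and closed sums\<close>

text \<open>A Hilbert space here has sort \<open>{real_inner, complete_space}\<close>, which the sort \<open>banach\<close> does not
  subsume; this is absolute convergence for such types.\<close>

lemma convergent_sum_of_summable_norm:
  fixes f :: "nat \<Rightarrow> 'a::{real_normed_vector, complete_space}"
  assumes "summable (\<lambda>k. norm (f k))"
  shows "convergent (\<lambda>n. \<Sum>k<n. f k)"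
proof (rule Cauchy_convergent, rule metric_CauchyI)
  fix e :: real assume "e > 0"
  then obtain N where N: "\<And>m n. m \<ge> N \<Longrightarrow> norm (\<Sum>k=m..<n. norm (f k)) < e"
    using assms unfolding summable_Cauchy by blast
  have ordered: "dist (\<Sum>k<m. f k) (\<Sum>k<n. f k) < e" if "m \<ge> N" "m \<le> n" for m n
  proof -
    have "dist (\<Sum>k<m. f k) (\<Sum>k<n. f k) = norm (\<Sum>k=m..<n. f k)"
      using that sum_diff_nat_ivl[of 0 m n f] 
      by (metis atLeast0LessThan dist_commute dist_norm le0)
    also have "\<dots> \<le> (\<Sum>k=m..<n. norm (f k))" by (rule norm_sum)
    also have "\<dots> < e" using N[of m n] that by (simp add: sum_nonneg)
    finally show ?thesis .
  qed
  show "\<exists>N. \<forall>m\<ge>N. \<forall>n\<ge>N. dist (\<Sum>k<m. f k) (\<Sum>k<n. f k) < e"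
    using ordered by (metis dist_commute nat_le_linear)
qed

lemma subspace_closure:
  fixes S :: "'a::real_normed_vector set"
  assumes "subspace S"
  shows "subspace (closure S)"
  unfolding subspace_def
proof (intro conjI allI ballI)
  show "0 \<in> closure S" using subspace_0[OF assms] closure_subset by blast
next
  fix x y assume "x \<in> closure S" "y \<in> closure S"
  then obtain f g where "\<And>n. f n \<in> S" "f \<longlonglongrightarrow> x" "\<And>n. g n \<in> S" "g \<longlonglongrightarrow> y"
    unfolding closure_sequential by blast
  then show "x + y \<in> closure S"
    unfolding closure_sequential
    by (intro exI[of _ "\<lambda>n. f n + g n"] conjI allI subspace_add[OF assms] tendsto_add)
next
  fix a :: real and x assume "x \<in> closure S"
  then obtain f where "\<And>n. f n \<in> S" "f \<longlonglongrightarrow> x"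
    unfolding closure_sequential by blast
  then show "a *\<^sub>R x \<in> closure S"
    unfolding closure_sequential
    by (intro exI[of _ "\<lambda>n. a *\<^sub>R f n"] conjI allI subspace_scale[OF assms] tendsto_scaleR tendsto_const)
qed

text \<open>The space \<open>l\<^sup>2(G)\<close> is a set of cochains and not a type, so its functional analysis is carried out
  for a norm \<open>p\<close> on a subspace \<open>L\<close>. Nonnegativity and symmetry of \<open>p\<close> are required outside of \<open>L\<close>
  too, because \<^locale>\<open>Metric_space\<close> asks for them on the whole type.\<close>

locale normed_subspace =
  fixes L :: "'b::real_vector set" and p :: "'b \<Rightarrow> real"
  assumes subspace_L: "subspace L"
    and p_nonneg: "p x \<ge> 0"
    and p_minus: "p (- x) = p x"
    and p_scale: "x \<in> L \<Longrightarrow> p (a *\<^sub>R x) = \<bar>a\<bar> * p x"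
    and p_triangle: "x \<in> L \<Longrightarrow> y \<in> L \<Longrightarrow> p (x + y) \<le> p x + p y"
    and p_eq_0: "x \<in> L \<Longrightarrow> p x = 0 \<Longrightarrow> x = 0"
begin

lemma p_0: "p 0 = 0"
  using p_scale[of 0 0] subspace_0[OF subspace_L] by simp

lemma p_diff: "p (x - y) = p (y - x)"
  using p_minus[of "x - y"] by simp

lemma p_triangle_diff:
  assumes "x \<in> L" "y \<in> L" "z \<in> L"
  shows "p (x - z) \<le> p (x - y) + p (y - z)"
  using p_triangle[of "x - y" "y - z"] assms subspace_diff[OF subspace_L] by simp

lemma p_diff_le:
  assumes "x \<in> L" "y \<in> L"
  shows "\<bar>p x - p y\<bar> \<le> p (x - y)"
  using p_triangle[of "x - y" y] p_triangle[of "y - x" x] p_diff[of x y]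
    assms subspace_diff[OF subspace_L] by fastforce

sublocale Metric_space L "\<lambda>x y. p (x - y)"
proof
  fix x y assume "x \<in> L" "y \<in> L"
  then show "p (x - y) = 0 \<longleftrightarrow> x = y"
    using p_eq_0[of "x - y"] p_0 subspace_diff[OF subspace_L] by auto
qed (auto simp: p_nonneg intro: p_diff p_triangle_diff)

text \<open>If \<open>b\<close> is outside the closed subspace \<open>Z\<close>, then it has a positive distance \<open>\<epsilon>\<close> to it, and
  homogeneity turns this into \<open>\<bar>t\<bar> \<epsilon> \<le> p (z + t b)\<close>: convergence of \<open>z\<^sub>n + t\<^sub>n b\<close> forces convergence
  of the scalars \<open>t\<^sub>n\<close>, hence of \<open>z\<^sub>n\<close>.\<close>

lemma closedin_add_line:
  assumes Z: "closedin mtopology Z" "subspace Z" and b: "b \<in> L"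
  shows "closedin mtopology {z + t *\<^sub>R b | z t. z \<in> Z}"
proof (cases "b \<in> Z")
  case True
  then have "{z + t *\<^sub>R b | z t. z \<in> Z} = Z"
    using Z(2) by (auto simp: subspace_add subspace_scale intro!: exI[where x = 0]
        exI[where x = "_ :: 'b"])
  then show ?thesis using Z(1) by simp
next
  case False
  have ZL: "Z \<subseteq> L"
    using Z(1) closedin_metric by blast
  obtain \<epsilon> where \<epsilon>: "\<epsilon> > 0" "disjnt Z (mball b \<epsilon>)"
    using Z(1) False b unfolding closedin_metric by blast
  have dist_b: "\<epsilon> \<le> p (b - z)" if "z \<in> Z" for z
    using \<epsilon>(2) that ZL b by (force simp: disjnt_iff)
  have coeff: "\<bar>t\<bar> * \<epsilon> \<le> p (z + t *\<^sub>R b)" if z: "z \<in> Z" for z t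
  proof (cases "t = 0")
    case False
    have "z + t *\<^sub>R b = t *\<^sub>R (b - (- (1/t)) *\<^sub>R z)"
      using False by (simp add: algebra_simps)
    moreover have "(- (1/t)) *\<^sub>R z \<in> Z"
      using Z(2) z by (rule subspace_scale)
    moreover have "b - (- (1/t)) *\<^sub>R z \<in> L"
      using calculation(2) ZL b subspace_diff[OF subspace_L] by blast
    ultimately show ?thesis
      using dist_b[of "(- (1/t)) *\<^sub>R z"] by (simp only: p_scale) (intro mult_left_mono; simp)
  qed (simp add: p_nonneg)
  have inL: "z + t *\<^sub>R b \<in> L" if "z \<in> Z" for z t
    using that ZL b by (auto intro!: subspace_add[OF subspace_L] subspace_scale[OF subspace_L])
  show ?thesis
    unfolding metric_closedin_iff_sequentially_closed
  proof (intro conjI allI impI)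
    show "{z + t *\<^sub>R b | z t. z \<in> Z} \<subseteq> L"
      using inL by auto
    fix \<sigma> y assume "range \<sigma> \<subseteq> {z + t *\<^sub>R b | z t. z \<in> Z} \<and> limitin mtopology \<sigma> y sequentially"
    then have range: "range \<sigma> \<subseteq> {z + t *\<^sub>R b | z t. z \<in> Z}"
      and lim: "limitin mtopology \<sigma> y sequentially" by auto
    from range have "\<forall>n. \<exists>z t. z \<in> Z \<and> \<sigma> n = z + t *\<^sub>R b" by blast
    then obtain z t where zt: "\<And>n. z n \<in> Z" "\<And>n. \<sigma> n = z n + t n *\<^sub>R b" by metis
    have yL: "y \<in> L"
      using lim by (simp add: limitin_metric)
    have \<sigma>L: "\<sigma> n \<in> L" for n
      using zt inL by simp
    have "MCauchy \<sigma>"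
      using lim \<sigma>L by (intro convergent_imp_MCauchy) auto
    have "Cauchy t"
    proof (rule metric_CauchyI)
      fix e :: real assume "e > 0"
      then obtain N where N: "\<And>m n. m \<ge> N \<Longrightarrow> n \<ge> N \<Longrightarrow> p (\<sigma> m - \<sigma> n) < e * \<epsilon>"
        using \<open>MCauchy \<sigma>\<close> \<epsilon>(1) unfolding MCauchy_def by (meson mult_pos_pos)
      show "\<exists>N. \<forall>m\<ge>N. \<forall>n\<ge>N. dist (t m) (t n) < e"
      proof (intro exI[of _ N] allI impI)
        fix m n assume "m \<ge> N" "n \<ge> N"
        have "\<sigma> m - \<sigma> n = (z m - z n) + (t m - t n) *\<^sub>R b"
          by (simp add: zt algebra_simps)
        then have "\<bar>t m - t n\<bar> * \<epsilon> \<le> p (\<sigma> m - \<sigma> n)"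
          using coeff[of "z m - z n" "t m - t n"] zt(1) subspace_diff[OF Z(2)] by simp
        also have "\<dots> < e * \<epsilon>"
          using N \<open>m \<ge> N\<close> \<open>n \<ge> N\<close> by blast
        finally show "dist (t m) (t n) < e"
          using \<epsilon>(1) by (simp add: dist_real_def)
      qed
    qed
    then obtain t0 where t0: "t \<longlonglongrightarrow> t0"
      using real_Cauchy_convergent convergent_def by blast
    have "limitin mtopology z (y - t0 *\<^sub>R b) sequentially"
      unfolding limitin_metric_dist_null
    proof (intro conjI always_eventually allI)
      show L0: "y - t0 *\<^sub>R b \<in> L"
        using yL b by (auto intro!: subspace_diff[OF subspace_L] subspace_scale[OF subspace_L])
      show "z n \<in> L" for n
        using zt ZL by auto
      have "(\<lambda>n. p (\<sigma> n - y) + \<bar>t0 - t n\<bar> * p b) \<longlonglongrightarrow> 0 + \<bar>t0 - t0\<bar> * p b"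
        using lim t0 by (intro tendsto_intros) (auto simp: limitin_metric_dist_null)
      then have *: "(\<lambda>n. p (\<sigma> n - y) + \<bar>t0 - t n\<bar> * p b) \<longlonglongrightarrow> 0" by simp
      have "p (z n - (y - t0 *\<^sub>R b)) \<le> p (\<sigma> n - y) + \<bar>t0 - t n\<bar> * p b" for n
      proof -
        have eq: "z n - (y - t0 *\<^sub>R b) = (\<sigma> n - y) + (t0 - t n) *\<^sub>R b"
          by (simp add: zt algebra_simps)
        show ?thesis
          unfolding eq
          using p_triangle[of "\<sigma> n - y" "(t0 - t n) *\<^sub>R b"] b \<sigma>L yL
          by (simp add: p_scale subspace_diff[OF subspace_L] subspace_scale[OF subspace_L])
      qed
      then show "(\<lambda>n. p (z n - (y - t0 *\<^sub>R b))) \<longlonglongrightarrow> 0"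
        by (intro tendsto_sandwich[OF _ _ tendsto_const *]) (auto simp: p_nonneg)
    qed
    then have "y - t0 *\<^sub>R b \<in> Z"
      using Z(1) zt(1) unfolding metric_closedin_iff_sequentially_closed by blast
    then show "y \<in> {z + t *\<^sub>R b | z t. z \<in> Z}"
      by (smt (verit) diff_add_cancel mem_Collect_eq)
  qed
qed

lemma closedin_add_span:
  assumes Z: "closedin mtopology Z" "subspace Z" and "finite B" "B \<subseteq> L"
  shows "closedin mtopology {z + v | z v. z \<in> Z \<and> v \<in> span B}"
  using \<open>finite B\<close> \<open>B \<subseteq> L\<close>
proof (induction B rule: finite_induct)
  case empty
  then show ?case using Z by simp
next
  case (insert b B)
  let ?Z = "{z + v | z v. z \<in> Z \<and> v \<in> span B}"
  have "{z + v | z v. z \<in> Z \<and> v \<in> span (insert b B)} = {z + t *\<^sub>R b | z t. z \<in> ?Z}"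
  proof (intro equalityI subsetI)
    fix x assume "x \<in> {z + v | z v. z \<in> Z \<and> v \<in> span (insert b B)}"
    then obtain z v k where *: "x = z + v" "z \<in> Z" "v - k *\<^sub>R b \<in> span B"
      by (auto simp: span_insert)
    then have "x = (z + (v - k *\<^sub>R b)) + k *\<^sub>R b" by simp
    with * show "x \<in> {z + t *\<^sub>R b | z t. z \<in> ?Z}" by blast
  next
    fix x assume "x \<in> {z + t *\<^sub>R b | z t. z \<in> ?Z}"
    then obtain z v t where *: "x = z + (v + t *\<^sub>R b)" "z \<in> Z" "v \<in> span B"
      by (auto simp: add.assoc)
    then have "v + t *\<^sub>R b \<in> span (insert b B)"
      by (auto simp: span_insert intro!: exI[of _ t])
    with * show "x \<in> {z + v | z v. z \<in> Z \<and> v \<in> span (insert b B)}" by blast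
  qed
  moreover have "subspace ?Z"
    using subspace_sums[OF Z(2) subspace_span[of B]] .
  ultimately show ?case
    using closedin_add_line[of ?Z b] insert by simp
qed

end

section \<open>Bounded operators with closed range\<close>

locale bounded_operator = normed_subspace L p
  for L :: "'b::real_vector set" and p :: "'b \<Rightarrow> real" +
  fixes T :: "'w::{real_normed_vector, complete_space} \<Rightarrow> 'b" and M :: real
  assumes linear_T: "linear T"
    and T_in: "T w \<in> L"
    and T_bound: "p (T w) \<le> M * norm w"
begin

lemma continuous_p_T: "continuous_on S (\<lambda>w. p (T w))"
proof -
  have "\<bar>p (T w) - p (T w')\<bar> \<le> \<bar>M\<bar> * norm (w - w')" for w w'
  proof -
    have "\<bar>p (T w) - p (T w')\<bar> \<le> p (T (w - w'))"
      using p_diff_le[OF T_in T_in] by (simp add: linear_diff[OF linear_T])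
    also have "\<dots> \<le> M * norm (w - w')" by (rule T_bound)
    also have "\<dots> \<le> \<bar>M\<bar> * norm (w - w')" by (intro mult_right_mono) auto
    finally show ?thesis .
  qed
  then have "\<bar>M\<bar>-lipschitz_on S (\<lambda>w. p (T w))"
    by (intro lipschitz_onI) (auto simp: dist_real_def dist_norm)
  then show ?thesis by (rule lipschitz_on_continuous_on)
qed

lemma limitin_T:
  assumes "f \<longlonglongrightarrow> w"
  shows "limitin mtopology (\<lambda>n. T (f n)) (T w) sequentially"
  unfolding limitin_metric_dist_null
proof (intro conjI always_eventually allI T_in)
  have "(\<lambda>n. M * norm (f n - w)) \<longlonglongrightarrow> M * norm (w - w)"
    using assms by (intro tendsto_intros)
  then have *: "(\<lambda>n. M * norm (f n - w)) \<longlonglongrightarrow> 0" by simp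
  show "(\<lambda>n. p (T (f n) - T w)) \<longlonglongrightarrow> 0"
    by (rule tendsto_sandwich[OF _ _ tendsto_const *])
      (auto simp: p_nonneg T_bound simp flip: linear_diff[OF linear_T])
qed

text \<open>The lower bound makes preimages of a Cauchy sequence Cauchy, so completeness of the domain
  provides the limit.\<close>

lemma closedin_image_of_bounded_below:
  assumes S: "closed S" "subspace S" and C: "C > 0" and below: "\<And>w. w \<in> S \<Longrightarrow> C * norm w \<le> p (T w)"
  shows "closedin mtopology (T ` S)"
  unfolding metric_closedin_iff_sequentially_closed
proof (intro conjI allI impI)
  show "T ` S \<subseteq> L" using T_in by auto
  fix \<sigma> y assume "range \<sigma> \<subseteq> T ` S \<and> limitin mtopology \<sigma> y sequentially"
  then have range: "\<forall>n. \<exists>w\<in>S. \<sigma> n = T w" and lim: "limitin mtopology \<sigma> y sequentially" by auto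
  from range obtain f where f: "\<And>n. f n \<in> S" "\<And>n. \<sigma> n = T (f n)" by metis
  have "MCauchy \<sigma>"
    using lim f T_in by (intro convergent_imp_MCauchy) auto
  have "Cauchy f"
  proof (rule metric_CauchyI)
    fix e :: real assume "e > 0"
    then obtain N where N: "\<And>m n. m \<ge> N \<Longrightarrow> n \<ge> N \<Longrightarrow> p (\<sigma> m - \<sigma> n) < C * e"
      using \<open>MCauchy \<sigma>\<close> C unfolding MCauchy_def by (meson mult_pos_pos)
    have "dist (f m) (f n) < e" if "m \<ge> N" "n \<ge> N" for m n
    proof -
      have "C * norm (f m - f n) \<le> p (\<sigma> m - \<sigma> n)"
        using below[of "f m - f n"] f S(2) by (simp add: subspace_diff linear_diff[OF linear_T])
      also have "\<dots> < C * e" using N that by blast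
      finally show ?thesis using C by (simp add: dist_norm)
    qed
    then show "\<exists>N. \<forall>m\<ge>N. \<forall>n\<ge>N. dist (f m) (f n) < e" by blast
  qed
  then obtain w where w: "f \<longlonglongrightarrow> w"
    using Cauchy_convergent convergent_def by blast
  then have "w \<in> S"
    using S(1) f(1) closed_sequentially by blast
  moreover have "limitin mtopology \<sigma> (T w) sequentially"
    using limitin_T[OF w] f(2) by presburger
  then have "y = T w"
    using lim limitin_metric_unique trivial_limit_sequentially by blast
  ultimately show "y \<in> T ` S" by blast
qed

text \<open>The Baire category half of the open mapping theorem. The range of \<open>T\<close> is a complete metric space
  and the union of the closures of the sets \<open>T (cball 0 n)\<close>, so one of these contains a ball around some
  \<open>y\<^sub>0\<close>. Subtracting approximate preimages of \<open>y\<^sub>0\<close> and \<open>y\<^sub>0 + y\<close> gives one of every small \<open>y\<close>, and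
  scaling makes the error proportional to \<open>p y\<close>.\<close>

lemma approximate_preimage:
  assumes "mcomplete" and closed: "closedin mtopology (range T)"
  obtains B where "B \<ge> 0" "\<And>y. y \<in> range T \<Longrightarrow> \<exists>w. norm w \<le> B * p y \<and> p (y - T w) \<le> p y / 2"
proof -
  interpret Y: Submetric L "\<lambda>x y. p (x - y)" "range T"
    by unfold_locales (use T_in in auto)
  let ?S = "\<lambda>n::nat. Y.sub.mtopology closure_of (T ` cball 0 n)"
  have "\<exists>n. Y.sub.mtopology interior_of ?S n \<noteq> {}"
  proof (rule ccontr)
    assume "\<not> ?thesis"
    then have "Y.sub.mtopology interior_of \<Union>(range ?S) = {}"
      using Y.closedin_mcomplete_imp_mcomplete[OF closed \<open>mcomplete\<close>]
      by (intro Y.sub.metric_Baire_category_alt) auto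
    moreover have "\<Union>(range ?S) = range T"
    proof
      show "\<Union>(range ?S) \<subseteq> range T"
        using closure_of_subset_topspace[of Y.sub.mtopology] by auto
      show "range T \<subseteq> \<Union>(range ?S)"
      proof clarsimp
        fix w :: 'w
        obtain n :: nat where "norm w \<le> n"
          using real_arch_simple by blast
        then have "T w \<in> T ` cball 0 n" by auto
        moreover have "T ` cball 0 n \<subseteq> ?S n"
          by (rule closure_of_subset) auto
        ultimately show "\<exists>n. T w \<in> ?S n" by blast
      qed
    qed
    ultimately show False
      using interior_of_topspace[of Y.sub.mtopology] by auto
  qed
  then obtain n y0 where "y0 \<in> Y.sub.mtopology interior_of ?S n" by blast
  then obtain \<epsilon> where \<epsilon>: "\<epsilon> > 0" "Y.sub.mball y0 \<epsilon> \<subseteq> ?S n" and y0: "y0 \<in> range T"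
    unfolding Y.sub.metric_interior_of by blast
  have appr: "\<exists>w. norm w \<le> n \<and> p (y - T w) < \<eta>" if "y \<in> ?S n" "\<eta> > 0" for y \<eta>
    using that unfolding Y.sub.metric_closure_of by (fastforce simp: Y.sub.in_mball)
  have small: "\<exists>w. norm w \<le> 2 * n \<and> p (y - T w) < \<epsilon> / 4" if y: "y \<in> range T" "p y < \<epsilon>" for y
  proof -
    have "y0 + y \<in> range T"
      using y0 y(1) subspace_add[OF linear_subspace_image[OF linear_T subspace_UNIV]] by blast
    then have "y0 + y \<in> Y.sub.mball y0 \<epsilon>" "y0 \<in> Y.sub.mball y0 \<epsilon>"
      using y y0 \<epsilon>(1) by (auto simp: Y.sub.in_mball p_minus p_0)
    then have "y0 + y \<in> ?S n" "y0 \<in> ?S n"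
      using \<epsilon>(2) by blast+
    then obtain w1 w0 where w: "norm w1 \<le> n" "p (y0 + y - T w1) < \<epsilon>/8"
      "norm w0 \<le> n" "p (y0 - T w0) < \<epsilon>/8"
      using appr[of "y0 + y" "\<epsilon>/8"] appr[of y0 "\<epsilon>/8"] \<epsilon>(1) by (meson divide_pos_pos zero_less_numeral)
    have L: "y0 + y - T w1 \<in> L" "y0 - T w0 \<in> L"
      using y0 y(1) T_in by (auto intro!: subspace_add[OF subspace_L] subspace_diff[OF subspace_L])
    have "y - T (w1 - w0) = (y0 + y - T w1) + - (y0 - T w0)"
      by (simp add: linear_diff[OF linear_T])
    then have "p (y - T (w1 - w0)) \<le> p (y0 + y - T w1) + p (y0 - T w0)"
      using p_triangle[OF L(1) subspace_neg[OF subspace_L L(2)]] p_minus by metis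
    moreover have "norm (w1 - w0) \<le> 2 * n"
      using norm_triangle_ineq4[of w1 w0] w by linarith
    ultimately show ?thesis using w by (intro exI[of _ "w1 - w0"]) linarith
  qed
  show ?thesis
  proof (rule that[of "4 * real n / \<epsilon>"])
    show "4 * real n / \<epsilon> \<ge> 0" using \<epsilon> by simp
    fix y assume y: "y \<in> range T"
    then have yL: "y \<in> L" using T_in by auto
    show "\<exists>w. norm w \<le> 4 * real n / \<epsilon> * p y \<and> p (y - T w) \<le> p y / 2"
    proof (cases "p y = 0")
      case True
      then have "y = 0" using p_eq_0 yL by blast
      then show ?thesis
        by (intro exI[of _ 0]) (simp add: linear_0[OF linear_T] p_0)
    next
      case False
      then have py: "p y > 0" using p_nonneg[of y] by simp
      \<comment> \<open>The factor 2 puts \<open>s y\<close> strictly inside the ball of radius \<open>\<epsilon>\<close>.\<close>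
      define s where "s = \<epsilon> / (2 * p y)"
      have s: "s > 0" using py \<epsilon> by (simp add: s_def)
      have "s *\<^sub>R y \<in> range T"
        using y subspace_scale[OF linear_subspace_image[OF linear_T subspace_UNIV]] by blast
      moreover have "p (s *\<^sub>R y) < \<epsilon>"
        using s py \<epsilon> by (simp add: p_scale[OF yL]) (simp add: s_def)
      ultimately obtain w where w: "norm w \<le> 2 * n" "p (s *\<^sub>R y - T w) < \<epsilon> / 4"
        using small by blast
      have "y - T (w /\<^sub>R s) = (1/s) *\<^sub>R (s *\<^sub>R y - T w)"
        using s by (simp add: linear_scale[OF linear_T] algebra_simps divide_inverse)
      moreover have "s *\<^sub>R y - T w \<in> L"
        using yL T_in by (auto intro!: subspace_diff[OF subspace_L] subspace_scale[OF subspace_L])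
      ultimately have "p (y - T (w /\<^sub>R s)) = p (s *\<^sub>R y - T w) / s"
        using s by (simp add: p_scale)
      also have "\<dots> \<le> (\<epsilon> / 4) / s"
        using w s by (intro divide_right_mono) auto
      also have "\<dots> = p y / 2" using \<epsilon> py by (simp add: s_def)
      finally have "p (y - T (w /\<^sub>R s)) \<le> p y / 2" .
      moreover have "norm (w /\<^sub>R s) \<le> 4 * real n / \<epsilon> * p y"
      proof -
        have "norm (w /\<^sub>R s) = norm w / s" using s by (simp add: divide_inverse_commute)
        also have "\<dots> \<le> 2 * n / s" using w s by (intro divide_right_mono) auto
        also have "\<dots> = 4 * real n / \<epsilon> * p y" using \<epsilon> py by (simp add: s_def)
        finally show ?thesis .
      qed
      ultimately show ?thesis by blast
    qed
  qed
qed

text \<open>The other half of the open mapping theorem: correcting the error of an approximate preimage again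
  and again halves it each time, and the corrections form an absolutely convergent series.\<close>

lemma bounded_preimage:
  assumes "mcomplete" and closed: "closedin mtopology (range T)"
  obtains B where "B \<ge> 0" "\<And>y. y \<in> range T \<Longrightarrow> \<exists>w. T w = y \<and> norm w \<le> B * p y"
proof -
  obtain B where B: "B \<ge> 0" "\<And>y. y \<in> range T \<Longrightarrow> \<exists>w. norm w \<le> B * p y \<and> p (y - T w) \<le> p y / 2"
    using approximate_preimage[OF assms] by blast
  then obtain g where g: "\<And>y. y \<in> range T \<Longrightarrow> norm (g y) \<le> B * p y"
    "\<And>y. y \<in> range T \<Longrightarrow> p (y - T (g y)) \<le> p y / 2" by metis
  show ?thesis
  proof (rule that[of "2 * B"])
    show "2 * B \<ge> 0" using B by simp
    fix y assume y: "y \<in> range T"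
    \<comment> \<open>\<open>R n\<close> is the error that remains after \<open>n\<close> corrections.\<close>
    define R where "R = rec_nat y (\<lambda>_ z. z - T (g z))"
    have R: "R 0 = y" "\<And>n. R (Suc n) = R n - T (g (R n))" by (simp_all add: R_def)
    have R_in: "R n \<in> range T" for n
    proof (induction n)
      case (Suc n)
      show ?case
        unfolding R(2)
        by (rule subspace_diff[OF linear_subspace_image[OF linear_T subspace_UNIV] Suc rangeI])
    qed (simp add: R(1) y)
    have p_R: "p (R n) \<le> p y * (1/2) ^ n" for n
    proof (induction n)
      case (Suc n)
      then show ?case using g(2)[OF R_in[of n]] R(2)[of n] by simp
    qed (simp add: R(1))
    have bound: "norm (g (R n)) \<le> B * p y * (1/2) ^ n" for n
      using order_trans[OF g(1)[OF R_in[of n]] mult_left_mono[OF p_R B(1)]] by (simp add: mult.assoc)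
    have geo: "(\<lambda>n. B * p y * (1/2) ^ n) sums (B * p y * 2)"
      using sums_mult[OF geometric_sums[of "1/2 :: real"], of "B * p y"] by simp
    have norm_sums: "(\<Sum>k<n. norm (g (R k))) \<le> B * p y * 2" for n
    proof -
      have "(\<Sum>k<n. norm (g (R k))) \<le> (\<Sum>k<n. B * p y * (1/2) ^ k)"
        by (rule sum_mono) (rule bound)
      also have "\<dots> \<le> (\<Sum>k. B * p y * (1/2) ^ k)"
        using B(1) p_nonneg[of y] by (intro sum_le_suminf[OF sums_summable[OF geo]]) auto
      also have "\<dots> = B * p y * 2" using sums_unique[OF geo] by simp
      finally show ?thesis .
    qed
    obtain w where w: "(\<lambda>n. \<Sum>k<n. g (R k)) \<longlonglongrightarrow> w"
      using convergent_sum_of_summable_norm[OF summable_comparison_test'[OF sums_summable[OF geo], of 0]]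
        bound unfolding convergent_def by fastforce
    have partial: "T (\<Sum>k<n. g (R k)) = y - R n" for n
      by (induction n) (simp_all add: R linear_add[OF linear_T] linear_0[OF linear_T])
    have "limitin mtopology (\<lambda>n. y - R n) (T w) sequentially"
      using limitin_T[OF w] by (simp add: partial)
    moreover have "limitin mtopology (\<lambda>n. y - R n) y sequentially"
      unfolding limitin_metric_dist_null
    proof (intro conjI always_eventually allI)
      show "y \<in> L" using y T_in by auto
      show "y - R n \<in> L" for n
        using y R_in T_in by (metis T_in partial)
      have "(\<lambda>n. p y * (1/2) ^ n) \<longlonglongrightarrow> p y * 0"
        by (intro tendsto_intros) (auto intro: LIMSEQ_realpow_zero)
      then have *: "(\<lambda>n. p y * (1/2) ^ n) \<longlonglongrightarrow> 0" by simp
      show "(\<lambda>n. p (y - R n - y)) \<longlonglongrightarrow> 0"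
        by (rule tendsto_sandwich[OF _ _ tendsto_const *]) (use p_R in \<open>auto simp: p_nonneg p_minus\<close>)
    qed
    ultimately have "T w = y"
      using limitin_metric_unique trivial_limit_sequentially by blast
    moreover have "norm w \<le> B * p y * 2"
      using w order_trans[OF norm_sum norm_sums]
      by (intro Lim_norm_ubound[OF _ w]) auto
    ultimately show "\<exists>w. T w = y \<and> norm w \<le> 2 * B * p y" by (auto simp: mult_ac)
  qed
qed

end

section \<open>Separating families of linear functionals\<close>

text \<open>Each functional either vanishes on \<open>N\<close> or cuts the dimension by one.\<close>

lemma finite_dim_of_separating:
  fixes h :: "'i \<Rightarrow> 'a::real_vector \<Rightarrow> real"
  assumes "finite F" and lin: "\<And>i. i \<in> F \<Longrightarrow> linear (h i)"
    and "subspace N" and "\<And>n. n \<in> N \<Longrightarrow> (\<And>i. i \<in> F \<Longrightarrow> h i n = 0) \<Longrightarrow> n = 0"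
  shows "\<exists>B. finite B \<and> span B = N"
  using assms
proof (induction F arbitrary: N rule: finite_induct)
  case empty
  then have "N = {0}" using subspace_0 by auto
  then show ?case by (intro exI[of _ "{}"]) simp
next
  case (insert i F)
  let ?N = "N \<inter> {n. h i n = 0}"
  have lin_i: "linear (h i)" using insert.prems(1) by simp
  have "subspace ?N"
    using insert.prems(2) linear_subspace_kernel[OF lin_i] by (rule subspace_inter)
  then have "\<exists>B. finite B \<and> span B = ?N"
  proof (rule insert.IH[rotated])
    fix n assume "n \<in> ?N" "\<And>i. i \<in> F \<Longrightarrow> h i n = 0"
    then show "n = 0" by (intro insert.prems(3)) auto
  qed (use insert.prems(1) in auto)
  then obtain B where B: "finite B" "span B = ?N" by blast
  show ?case
  proof (cases "N \<subseteq> {n. h i n = 0}")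
    case True
    then show ?thesis using B by (auto simp: Int_absorb2)
  next
    case False
    then obtain n0 where n0: "n0 \<in> N" "h i n0 \<noteq> 0" by blast
    have "span (insert n0 B) = N"
    proof
      show "span (insert n0 B) \<subseteq> N"
        using n0(1) B(2) span_superset[of B] by (intro span_minimal insert.prems(2)) auto
      show "N \<subseteq> span (insert n0 B)"
      proof
        fix n assume "n \<in> N"
        then have "n - (h i n / h i n0) *\<^sub>R n0 \<in> span B"
          using n0 insert.prems(2) unfolding B(2)
          by (auto simp: linear_diff[OF lin_i] linear_scale[OF lin_i] intro: subspace_diff subspace_scale)
        then show "n \<in> span (insert n0 B)" by (auto simp: span_insert)
      qed
    qed
    with B(1) show ?thesis by (intro exI[of _ "insert n0 B"]) simp
  qed
qed

text \<open>Finitely many functionals of a separating family suffice to recover the vectors of a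
  finite-dimensional space, linearly. This replaces a compactness argument on the unit sphere: once the
  \<open>h i\<close> are bounded, it bounds the norm of \<open>n\<close> by the values \<open>h i n\<close>. If \<open>F\<close> and \<open>e\<close> serve for \<open>span B\<close>,
  the error \<open>P\<close> of the recovery formula has rank at most one on \<open>span (insert b B)\<close>, and one more
  functional that does not vanish on \<open>P b\<close> repairs it.\<close>

lemma coordinates_of_separating:
  fixes h :: "'i \<Rightarrow> 'a::real_vector \<Rightarrow> real"
  assumes "finite B" and lin: "\<And>i. i \<in> I \<Longrightarrow> linear (h i)"
    and "\<And>n. n \<in> span B \<Longrightarrow> (\<And>i. i \<in> I \<Longrightarrow> h i n = 0) \<Longrightarrow> n = 0"
  shows "\<exists>F e. finite F \<and> F \<subseteq> I \<and> range e \<subseteq> span B \<and> (\<forall>n\<in>span B. n = (\<Sum>i\<in>F. h i n *\<^sub>R e i))"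
  using assms(1,3)
proof (induction B rule: finite_induct)
  case empty
  show ?case by (intro exI[of _ "{}"] exI[of _ "\<lambda>_. 0"]) simp
next
  case (insert b B)
  have mono: "span B \<subseteq> span (insert b B)" by (intro span_mono) auto
  then have "\<exists>F e. finite F \<and> F \<subseteq> I \<and> range e \<subseteq> span B \<and> (\<forall>n\<in>span B. n = (\<Sum>i\<in>F. h i n *\<^sub>R e i))"
    using insert.IH insert.prems by blast
  then obtain F e where F: "finite F" "F \<subseteq> I" and e_in: "range e \<subseteq> span B"
    and e: "\<And>n. n \<in> span B \<Longrightarrow> n = (\<Sum>i\<in>F. h i n *\<^sub>R e i)"
    by blast
  define P where "P = (\<lambda>n. n - (\<Sum>i\<in>F. h i n *\<^sub>R e i))"
  have P_0: "P n = 0" if "n \<in> span B" for n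
    using e[OF that] by (simp add: P_def)
  have lin_F: "linear (h i)" if "i \<in> F" for i using that F lin by blast
  have lin_P: "linear P"
    by (intro linearI)
      (simp_all add: P_def linear_add[OF lin_F] linear_scale[OF lin_F] algebra_simps sum.distrib
        scaleR_sum_right cong: sum.cong)
  have decomp: "\<exists>t. P n = t *\<^sub>R P b" if n: "n \<in> span (insert b B)" for n
  proof -
    obtain t where "n - t *\<^sub>R b \<in> span B" using n by (auto simp: span_insert)
    then have "P n = t *\<^sub>R P b"
      using P_0[of "n - t *\<^sub>R b"] by (simp add: linear_diff[OF lin_P] linear_scale[OF lin_P])
    then show ?thesis by blast
  qed
  show ?case
  proof (cases "P b = 0")
    case True
    then have "P n = 0" if "n \<in> span (insert b B)" for n
      using decomp[OF that] by auto
    then have "\<forall>n\<in>span (insert b B). n = (\<Sum>i\<in>F. h i n *\<^sub>R e i)"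
      by (simp add: P_def)
    moreover have "range e \<subseteq> span (insert b B)" using e_in mono by blast
    ultimately show ?thesis using F by blast
  next
    case False
    have Pb_in: "P b \<in> span (insert b B)"
      unfolding P_def using e_in mono
      by (intro span_diff span_sum span_scale span_base[of b]) auto
    then obtain i0 where i0: "i0 \<in> I" "h i0 (P b) \<noteq> 0"
      using insert.prems False by blast
    have lin_i0: "linear (h i0)" using lin i0(1) .
    define v where "v = P b /\<^sub>R h i0 (P b)"
    \<comment> \<open>The new index \<open>i0\<close> may already lie in \<open>F\<close>; the two summands are then added.\<close>
    define e' where "e' = (\<lambda>i. (if i \<in> F then e i - h i0 (e i) *\<^sub>R v else 0) + (if i = i0 then v else 0))"
    have v_in: "v \<in> span (insert b B)"
      using Pb_in unfolding v_def by (rule span_scale)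
    have "n = (\<Sum>i\<in>insert i0 F. h i n *\<^sub>R e' i)" if n: "n \<in> span (insert b B)" for n
    proof -
      obtain t where t: "P n = t *\<^sub>R P b" using decomp[OF n] by blast
      then have "P n = h i0 (P n) *\<^sub>R v"
        using i0(2) by (simp add: v_def linear_scale[OF lin_i0])
      also have "h i0 (P n) = h i0 n - (\<Sum>i\<in>F. h i n * h i0 (e i))"
        by (simp add: P_def linear_diff[OF lin_i0] linear_sum[OF lin_i0] linear_scale[OF lin_i0])
      finally have "n = (\<Sum>i\<in>F. h i n *\<^sub>R e i) + (h i0 n - (\<Sum>i\<in>F. h i n * h i0 (e i))) *\<^sub>R v"
        by (simp add: P_def algebra_simps)
      also have "\<dots> = (\<Sum>i\<in>F. h i n *\<^sub>R (e i - h i0 (e i) *\<^sub>R v)) + h i0 n *\<^sub>R v"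
        by (simp add: algebra_simps sum_subtractf scaleR_sum_left)
      also have "(\<Sum>i\<in>F. h i n *\<^sub>R (e i - h i0 (e i) *\<^sub>R v))
          = (\<Sum>i\<in>insert i0 F. h i n *\<^sub>R (if i \<in> F then e i - h i0 (e i) *\<^sub>R v else 0))"
        using F(1) by (intro sum.mono_neutral_cong_left) auto
      also have "h i0 n *\<^sub>R v = (\<Sum>i\<in>insert i0 F. h i n *\<^sub>R (if i = i0 then v else 0))"
        using F(1) by (simp add: if_distrib[of "scaleR _"] cong: if_cong)
      finally show ?thesis
        by (simp add: e'_def scaleR_add_right sum.distrib)
    qed
    moreover have "range e' \<subseteq> span (insert b B)"
      using e_in mono v_in 
      by (auto simp: e'_def image_subset_iff subset_iff intro!: span_add span_diff span_scale span_0)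
    ultimately show ?thesis using F i0(1) by (intro exI[of _ "insert i0 F"] exI[of _ e']) blast
  qed
qed

lemma bounded_linear_of_continuous:
  fixes h :: "'a::real_normed_vector \<Rightarrow> real"
  assumes "linear h" "continuous_on UNIV h"
  shows "bounded_linear h"
proof -
  have "isCont h 0"
    using assms(2) continuous_on_eq_continuous_at open_UNIV by blast
  then obtain d where d: "d > 0" "\<And>x. norm x < d \<Longrightarrow> \<bar>h x\<bar> < 1"
    using linear_0[OF assms(1)]
    unfolding continuous_at_eps_delta dist_norm by (metis diff_zero real_norm_def zero_less_one)
  have "\<bar>h x\<bar> \<le> norm x * (2 / d)" for x
  proof (cases "x = 0")
    case False
    define s where "s = d / (2 * norm x)"
    have "s > 0" using d False by (simp add: s_def)
    moreover have "norm (s *\<^sub>R x) < d" using d(1) False by (simp add: s_def)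
    ultimately have "s * \<bar>h x\<bar> < 1"
      using d(2)[of "s *\<^sub>R x"] by (simp add: linear_scale[OF assms(1)] abs_mult)
    then show ?thesis using d(1) False by (simp add: s_def field_simps)
  qed (simp add: linear_0[OF assms(1)])
  then show ?thesis
    using assms(1) by (intro bounded_linear.intro bounded_linear_axioms.intro exI[of _ "2 / d"]) auto
qed

section \<open>Completeness of \<open>l\<^sup>2(G)\<close>\<close>

primrec coord :: "'v + 'v \<times> 'v \<Rightarrow> 'v cochain \<Rightarrow> real" where
  "coord (Inl x) u = fst u x"
| "coord (Inr e) u = snd u e"

lemma coord_add: "coord s (u + v) = coord s u + coord s v"
  by (cases s) auto

lemma coord_diff: "coord s (u - v) = coord s u - coord s v"
  by (cases s) auto

lemma coord_scaleR: "coord s (a *\<^sub>R u) = a * coord s u"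
  by (cases s) auto

lemma coord_eqI:
  assumes "\<And>s. coord s u = coord s v"
  shows "u = v"
proof (rule prod_eqI)
  show "fst u = fst v" using assms[of "Inl _"] by (simp add: fun_eq_iff)
  show "snd u = snd v" using assms[of "Inr _"] by (simp add: fun_eq_iff del: split_paired_All)
qed

lemma continuous_coord: "continuous_on UNIV (coord s)"
proof (cases s)
  case (Inl x)
  have "continuous_on UNIV (\<lambda>u::'a cochain. fst u x)"
    by (rule continuous_on_product_then_coordinatewise[OF continuous_on_fst[OF continuous_on_id]])
  moreover have "coord s = (\<lambda>u. fst u x)" using Inl by (simp add: fun_eq_iff)
  ultimately show ?thesis by simp
next
  case (Inr e)
  have "continuous_on UNIV (\<lambda>u::'a cochain. snd u e)"
    by (rule continuous_on_product_then_coordinatewise[OF continuous_on_snd[OF continuous_on_id]])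
  moreover have "coord s = (\<lambda>u. snd u e)" using Inr by (simp add: fun_eq_iff)
  ultimately show ?thesis by simp
qed

lemma subspace_cochains: "subspace (cochains G)"
  by (rule subspaceI) (auto simp: cochains_def vfuns_def efuns_def mem_Times_iff simp del: split_paired_All)

context weighted_graph
begin

text \<open>Finite partial sums of the squared norm pass to pointwise limits, and their boundedness
  characterises \<open>l\<^sup>2(G)\<close>: together these two facts give completeness.\<close>

definition partial_energy :: "'v set \<Rightarrow> ('v \<times> 'v) set \<Rightarrow> 'v cochain \<Rightarrow> real" where
  "partial_energy F H u = (\<Sum>x\<in>F. c x * (fst u x)\<^sup>2) + 1/2 * (\<Sum>e\<in>H. r e * (snd u e)\<^sup>2)"

lemma l2_norm_power2:
  "(l2_norm G c r u)\<^sup>2 = (\<Sum>\<^sub>\<infinity>x\<in>pverts G. c x * (fst u x)\<^sup>2) + 1/2 * (\<Sum>\<^sub>\<infinity>e\<in>parcs G. r e * (snd u e)\<^sup>2)"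
proof -
  have "(\<Sum>\<^sub>\<infinity>x\<in>pverts G. c x * (fst u x)\<^sup>2) \<ge> 0" "(\<Sum>\<^sub>\<infinity>e\<in>parcs G. r e * (snd u e)\<^sup>2) \<ge> 0"
    using c_pos r_pos by (auto simp: less_imp_le intro!: infsum_nonneg)
  then show ?thesis
    by (simp add: l2_norm_def l2V_norm_def l2E_norm_def)
qed

lemma l2_norm_nonneg: "l2_norm G c r u \<ge> 0"
  by (simp add: l2_norm_def)

lemma partial_energy_le:
  assumes "u \<in> l2 G c r" "finite F" "F \<subseteq> pverts G" "finite H" "H \<subseteq> parcs G"
  shows "partial_energy F H u \<le> (l2_norm G c r u)\<^sup>2"
proof -
  have "(\<Sum>x\<in>F. c x * (fst u x)\<^sup>2) \<le> (\<Sum>\<^sub>\<infinity>x\<in>pverts G. c x * (fst u x)\<^sup>2)"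
    using assms c_pos by (intro finite_sum_le_infsum) (auto simp: l2_def l2V_def less_imp_le)
  moreover have "(\<Sum>e\<in>H. r e * (snd u e)\<^sup>2) \<le> (\<Sum>\<^sub>\<infinity>e\<in>parcs G. r e * (snd u e)\<^sup>2)"
    using assms r_pos by (intro finite_sum_le_infsum) (auto simp: l2_def l2E_def less_imp_le)
  ultimately show ?thesis
    by (simp add: partial_energy_def l2_norm_power2)
qed

text \<open>With \<open>F\<close> fixed the bound passes to the sum over all edges, and then to the sum over all vertices.\<close>

lemma l2_of_partial_energy_le:
  assumes u: "u \<in> cochains G" and "b \<ge> 0"
    and le: "\<And>F H. finite F \<Longrightarrow> F \<subseteq> pverts G \<Longrightarrow> finite H \<Longrightarrow> H \<subseteq> parcs G \<Longrightarrow> partial_energy F H u \<le> b\<^sup>2"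
  shows "u \<in> l2 G c r" "l2_norm G c r u \<le> b"
proof -
  have V: "(\<lambda>x. c x * (fst u x)\<^sup>2) summable_on pverts G"
  proof (rule nonneg_bdd_above_summable_on)
    show "bdd_above (sum (\<lambda>x. c x * (fst u x)\<^sup>2) ` {F. F \<subseteq> pverts G \<and> finite F})"
      using le[of _ "{}"] by (auto simp: bdd_above_def partial_energy_def)
  qed (use c_pos in \<open>auto simp: less_imp_le\<close>)
  have E: "(\<lambda>e. r e * (snd u e)\<^sup>2) summable_on parcs G"
  proof (rule nonneg_bdd_above_summable_on)
    have "sum (\<lambda>e. r e * (snd u e)\<^sup>2) H \<le> 2 * b\<^sup>2" if "finite H" "H \<subseteq> parcs G" for H
      using le[of "{}" H] that by (simp add: partial_energy_def)
    then show "bdd_above (sum (\<lambda>e. r e * (snd u e)\<^sup>2) ` {F. F \<subseteq> parcs G \<and> finite F})"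
      unfolding bdd_above_def by blast
  qed (use r_pos in \<open>auto simp: less_imp_le\<close>)
  show "u \<in> l2 G c r"
    using u V E unfolding l2_def l2V_def l2E_def cochains_def by (simp add: mem_Times_iff)
  have "(\<Sum>\<^sub>\<infinity>x\<in>pverts G. c x * (fst u x)\<^sup>2) \<le> b\<^sup>2 - 1/2 * (\<Sum>\<^sub>\<infinity>e\<in>parcs G. r e * (snd u e)\<^sup>2)"
  proof (rule infsum_le_finite_sums[OF V])
    fix F assume F: "finite F" "F \<subseteq> pverts G"
    have "(\<Sum>\<^sub>\<infinity>e\<in>parcs G. r e * (snd u e)\<^sup>2) \<le> 2 * (b\<^sup>2 - (\<Sum>x\<in>F. c x * (fst u x)\<^sup>2))"
    proof (rule infsum_le_finite_sums[OF E])
      fix H assume "finite H" "H \<subseteq> parcs G"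
      then show "(\<Sum>e\<in>H. r e * (snd u e)\<^sup>2) \<le> 2 * (b\<^sup>2 - (\<Sum>x\<in>F. c x * (fst u x)\<^sup>2))"
        using le[OF F, of H] by (simp add: partial_energy_def)
    qed
    then show "(\<Sum>x\<in>F. c x * (fst u x)\<^sup>2) \<le> b\<^sup>2 - 1/2 * (\<Sum>\<^sub>\<infinity>e\<in>parcs G. r e * (snd u e)\<^sup>2)"
      by simp
  qed
  then have "(l2_norm G c r u)\<^sup>2 \<le> b\<^sup>2"
    by (simp add: l2_norm_power2)
  then show "l2_norm G c r u \<le> b"
    using \<open>b \<ge> 0\<close> by (rule power2_le_imp_le)
qed

lemma l2_subset_cochains: "l2 G c r \<subseteq> cochains G"
  by (auto simp: l2_def l2V_def l2E_def cochains_def)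

lemma l2_scaleR:
  assumes "u \<in> l2 G c r"
  shows "a *\<^sub>R u \<in> l2 G c r"
proof -
  have "(\<lambda>x. c x * (a * f x)\<^sup>2) = (\<lambda>x. a\<^sup>2 * (c x * (f x)\<^sup>2))"
    "(\<lambda>e. r e * (a * g e)\<^sup>2) = (\<lambda>e. a\<^sup>2 * (r e * (g e)\<^sup>2))" for f g
    by (auto simp: power_mult_distrib)
  then show ?thesis
    using assms subspace_scale[OF subspace_cochains, of u G a]
    by (auto simp: l2_def l2V_def l2E_def cochains_def mem_Times_iff intro: summable_on_cmult_right)
qed

lemma l2_norm_scaleR: "l2_norm G c r (a *\<^sub>R u) = \<bar>a\<bar> * l2_norm G c r u"
proof -
  have eq: "(\<lambda>x. c x * (a * f x)\<^sup>2) = (\<lambda>x. a\<^sup>2 * (c x * (f x)\<^sup>2))"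
    "(\<lambda>e. r e * (a * g e)\<^sup>2) = (\<lambda>e. a\<^sup>2 * (r e * (g e)\<^sup>2))" for f g
    by (auto simp: power_mult_distrib)
  have "(l2_norm G c r (a *\<^sub>R u))\<^sup>2 = (\<bar>a\<bar> * l2_norm G c r u)\<^sup>2"
    unfolding power_mult_distrib[of "\<bar>a\<bar>"] l2_norm_power2
    by (simp add: eq infsum_cmult_right' distrib_left)
  then show ?thesis
    using l2_norm_nonneg by (simp add: power2_eq_iff_nonneg)
qed

sublocale l2: normed_subspace "l2 G c r" "l2_norm G c r"
proof
  have "0 \<in> l2 G c r"
    by (rule l2_of_partial_energy_le[of _ 0])
      (simp_all add: subspace_0[OF subspace_cochains] partial_energy_def)
  then show "subspace (l2 G c r)"
    by (intro subspaceI l2_add l2_scaleR)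
  fix u
  show "u = 0" if "u \<in> l2 G c r" "l2_norm G c r u = 0"
    using that Metric_space.zero[OF Metric_space_l2, of u 0] \<open>0 \<in> l2 G c r\<close> by (simp add: l2_dist_def)
qed (simp_all add: l2_norm_nonneg l2_norm_minus l2_norm_scaleR l2_norm_triangle)

lemma l2_topology_eq: "l2_topology G c r = l2.mtopology"
proof -
  have "l2_dist G c r = (\<lambda>u v. l2_norm G c r (u - v))"
    by (simp add: l2_dist_def fun_eq_iff del: split_paired_All)
  then show ?thesis by (simp add: l2_topology_def)
qed

lemma coord_eq_0_outside:
  assumes "u \<in> cochains G"
  shows "x \<notin> pverts G \<Longrightarrow> coord (Inl x) u = 0" "e \<notin> parcs G \<Longrightarrow> coord (Inr e) u = 0"
  using assms unfolding cochains_def vfuns_def efuns_def mem_Times_iff coord.simps by blast+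

lemma coord_le_l2_norm: "\<exists>k\<ge>0. \<forall>u\<in>l2 G c r. \<bar>coord s u\<bar> \<le> k * l2_norm G c r u"
proof -
  have *: "\<bar>y\<bar> \<le> 1 / sqrt w * l2_norm G c r u" if "w > 0" "w * y\<^sup>2 \<le> (l2_norm G c r u)\<^sup>2" for w y u
  proof -
    have "(\<bar>y\<bar> * sqrt w)\<^sup>2 \<le> (l2_norm G c r u)\<^sup>2"
      using that by (simp add: power_mult_distrib mult.commute[of "y\<^sup>2"])
    then have "\<bar>y\<bar> * sqrt w \<le> l2_norm G c r u"
      using l2_norm_nonneg by (rule power2_le_imp_le)
    then show ?thesis using that(1) by (simp add: field_simps)
  qed
  have zero: ?thesis if "\<And>u. u \<in> l2 G c r \<Longrightarrow> coord s u = 0"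
    using that by (intro exI[of _ 0]) simp
  show ?thesis
  proof (cases s)
    case (Inl x)
    show ?thesis
    proof (cases "x \<in> pverts G")
      case True
      have "\<bar>coord s u\<bar> \<le> 1 / sqrt (c x) * l2_norm G c r u" if "u \<in> l2 G c r" for u
        using partial_energy_le[OF that, of "{x}" "{}"] True c_pos[OF True] Inl
        by (intro *) (auto simp: partial_energy_def)
      then show ?thesis
        using c_pos[OF True] by (intro exI[of _ "1 / sqrt (c x)"]) auto
    next
      case False
      then show ?thesis
        using l2_subset_cochains Inl coord_eq_0_outside(1) by (intro zero) blast
    qed
  next
    case (Inr e)
    show ?thesis
    proof (cases "e \<in> parcs G")
      case True
      have "\<bar>coord s u\<bar> \<le> 1 / sqrt (r e / 2) * l2_norm G c r u" if "u \<in> l2 G c r" for u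
        using partial_energy_le[OF that, of "{}" "{e}"] True r_pos[OF True] Inr
        by (intro *) (auto simp: partial_energy_def)
      then show ?thesis
        using r_pos[OF True] by (intro exI[of _ "1 / sqrt (r e / 2)"]) auto
    next
      case False
      then show ?thesis
        using l2_subset_cochains Inr coord_eq_0_outside(2) by (intro zero) blast
    qed
  qed
qed

lemma l2_mcomplete: "l2.mcomplete"
  unfolding l2.mcomplete_def
proof (intro allI impI)
  fix \<sigma> assume "l2.MCauchy \<sigma>"
  then have \<sigma>: "\<And>n. \<sigma> n \<in> l2 G c r" and Cauchy:
    "\<And>\<epsilon>. \<epsilon> > 0 \<Longrightarrow> \<exists>N. \<forall>n n'. N \<le> n \<longrightarrow> N \<le> n' \<longrightarrow> l2_norm G c r (\<sigma> n - \<sigma> n') < \<epsilon>"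
    unfolding l2.MCauchy_def by blast+
  have diff: "\<sigma> m - \<sigma> n \<in> l2 G c r" for m n
    using \<sigma> by (intro subspace_diff[OF l2.subspace_L])
  have "\<exists>l. (\<lambda>n. coord s (\<sigma> n)) \<longlonglongrightarrow> l" for s
  proof -
    obtain k where k: "k \<ge> 0" "\<And>u. u \<in> l2 G c r \<Longrightarrow> \<bar>coord s u\<bar> \<le> k * l2_norm G c r u"
      using coord_le_l2_norm by blast
    have "Cauchy (\<lambda>n. coord s (\<sigma> n))"
    proof (rule metric_CauchyI)
      fix e :: real assume "e > 0"
      then obtain N where N: "\<And>m n. N \<le> m \<Longrightarrow> N \<le> n \<Longrightarrow> l2_norm G c r (\<sigma> m - \<sigma> n) < e / (k + 1)"
        using Cauchy[of "e / (k + 1)"] k(1) by auto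
      have "dist (coord s (\<sigma> m)) (coord s (\<sigma> n)) < e" if "N \<le> m" "N \<le> n" for m n
      proof -
        have "dist (coord s (\<sigma> m)) (coord s (\<sigma> n)) \<le> k * l2_norm G c r (\<sigma> m - \<sigma> n)"
          using k(2)[OF diff] by (simp add: dist_real_def coord_diff)
        also have "\<dots> \<le> (k + 1) * l2_norm G c r (\<sigma> m - \<sigma> n)"
          using l2_norm_nonneg by (intro mult_right_mono) auto
        also have "\<dots> < e" using N[OF that] k(1) by (simp add: field_simps)
        finally show ?thesis .
      qed
      then show "\<exists>N. \<forall>m\<ge>N. \<forall>n\<ge>N. dist (coord s (\<sigma> m)) (coord s (\<sigma> n)) < e" by blast
    qed
    then show ?thesis using real_Cauchy_convergent convergent_def by blast
  qed
  then obtain l where l: "\<And>s. (\<lambda>n. coord s (\<sigma> n)) \<longlonglongrightarrow> l s" by metis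
  define u :: "'v cochain" where "u = ((\<lambda>x. l (Inl x)), (\<lambda>e. l (Inr e)))"
  have \<sigma>_cochain: "\<sigma> n \<in> cochains G" for n
    using \<sigma> l2_subset_cochains by blast
  have lim_fst: "(\<lambda>n. fst (\<sigma> n) x) \<longlonglongrightarrow> fst u x" for x
    using l[of "Inl x"] by (simp add: u_def)
  have lim_snd: "(\<lambda>n. snd (\<sigma> n) e) \<longlonglongrightarrow> snd u e" for e
    using l[of "Inr e"] by (simp add: u_def)
  have u: "u \<in> cochains G"
  proof -
    have "fst u x = 0" if "x \<notin> pverts G" for x
    proof -
      have "fst (\<sigma> n) x = 0" for n
        using \<sigma>_cochain[of n] that by (auto simp: cochains_def vfuns_def)
      then show ?thesis using lim_fst[of x] by (simp add: LIMSEQ_const_iff)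
    qed
    moreover have "snd u e = 0" if "e \<notin> parcs G" for e
    proof -
      have "snd (\<sigma> n) e = 0" for n
        using coord_eq_0_outside(2)[OF \<sigma>_cochain that] by simp
      then show ?thesis using lim_snd[of e] by (simp add: LIMSEQ_const_iff)
    qed
    moreover have "snd u (prod.swap e) = - snd u e" if "e \<in> parcs G" for e
    proof -
      have "snd (\<sigma> n) (prod.swap e) = - snd (\<sigma> n) e" for n
        using \<sigma>_cochain[of n] that unfolding cochains_def efuns_def by auto
      then have "(\<lambda>n. - snd (\<sigma> n) e) \<longlonglongrightarrow> snd u (prod.swap e)"
        using lim_snd[of "prod.swap e"] by simp
      then show ?thesis
        using tendsto_minus[OF lim_snd[of e]] LIMSEQ_unique by blast
    qed
    ultimately show ?thesis
      unfolding cochains_def vfuns_def efuns_def mem_Times_iff by blast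
  qed
  have close: "\<exists>N. \<forall>n\<ge>N. \<sigma> n - u \<in> l2 G c r \<and> l2_norm G c r (\<sigma> n - u) \<le> \<epsilon>" if "\<epsilon> > 0" for \<epsilon>
  proof -
    obtain N where N: "\<And>m n. N \<le> m \<Longrightarrow> N \<le> n \<Longrightarrow> l2_norm G c r (\<sigma> m - \<sigma> n) < \<epsilon>"
      using Cauchy[OF \<open>\<epsilon> > 0\<close>] by blast
    have "partial_energy F H (\<sigma> n - u) \<le> \<epsilon>\<^sup>2"
      if "n \<ge> N" "finite F" "F \<subseteq> pverts G" "finite H" "H \<subseteq> parcs G" for n F H
    proof (rule LIMSEQ_le_const2)
      show "(\<lambda>m. partial_energy F H (\<sigma> n - \<sigma> m)) \<longlonglongrightarrow> partial_energy F H (\<sigma> n - u)"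
        unfolding partial_energy_def using lim_fst lim_snd
        by (auto intro!: tendsto_intros)
      have "partial_energy F H (\<sigma> n - \<sigma> m) \<le> \<epsilon>\<^sup>2" if "m \<ge> N" for m
        using partial_energy_le[OF diff, of F H n m] N[of n m] that \<open>n \<ge> N\<close>
          power_mono[of "l2_norm G c r (\<sigma> n - \<sigma> m)" \<epsilon> 2] l2_norm_nonneg
          \<open>finite F\<close> \<open>F \<subseteq> pverts G\<close> \<open>finite H\<close> \<open>H \<subseteq> parcs G\<close> by fastforce
      then show "\<exists>N. \<forall>m\<ge>N. partial_energy F H (\<sigma> n - \<sigma> m) \<le> \<epsilon>\<^sup>2" by blast
    qed
    moreover have "\<sigma> n - u \<in> cochains G" for n
      using u \<sigma>_cochain by (intro subspace_diff[OF subspace_cochains])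
    ultimately have "\<sigma> n - u \<in> l2 G c r \<and> l2_norm G c r (\<sigma> n - u) \<le> \<epsilon>" if "n \<ge> N" for n
      using that \<open>\<epsilon> > 0\<close> l2_of_partial_energy_le[of "\<sigma> n - u" \<epsilon>] by (simp add: less_imp_le)
    then show ?thesis by blast
  qed
  have "u \<in> l2 G c r"
  proof -
    obtain n where "\<sigma> n - u \<in> l2 G c r" using close[of 1] by auto
    then show ?thesis
      using subspace_diff[OF l2.subspace_L \<sigma>[of n]] by fastforce
  qed
  moreover have "\<exists>N. \<forall>n\<ge>N. \<sigma> n \<in> l2 G c r \<and> l2_norm G c r (\<sigma> n - u) < \<epsilon>" if "\<epsilon> > 0" for \<epsilon>
  proof -
    obtain N where "\<forall>n\<ge>N. \<sigma> n - u \<in> l2 G c r \<and> l2_norm G c r (\<sigma> n - u) \<le> \<epsilon> / 2"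
      using close[of "\<epsilon> / 2"] \<open>\<epsilon> > 0\<close> by auto
    then show ?thesis using \<open>\<epsilon> > 0\<close> \<sigma> by (intro exI[of _ N]) fastforce
  qed
  ultimately show "\<exists>x. limitin l2.mtopology \<sigma> x sequentially"
    unfolding l2.limit_metric_sequentially by blast
qed

end

section \<open>The Gauss-Bonnet operator on its domain\<close>

locale gauss_bonnet_extension = weighted_graph G c r
  for G :: "'v pair_pre_digraph" and c r +
  fixes \<iota> :: "'v cochain \<Rightarrow> 'w::{real_normed_vector, complete_space}"
    and T :: "'w \<Rightarrow> 'v cochain" and j :: "'w \<Rightarrow> 'v cochain" and M :: real
  assumes \<iota>_dense: "dense_subspace_via G \<iota>"
    and cont_j: "continuous_on UNIV j" and inj_j: "inj j"
    and j_\<iota>: "u \<in> cochains0 G \<Longrightarrow> j (\<iota> u) = u"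
    and j_in: "j w \<in> cochains G"
    and T_linear: "linear T" and T_l2: "T w \<in> l2 G c r"
    and T_le: "l2_norm G c r (T w) \<le> M * norm w"
    and T_\<iota>: "u \<in> cochains0 G \<Longrightarrow> T (\<iota> u) = gauss_bonnet G c r u"

sublocale gauss_bonnet_extension \<subseteq> T: bounded_operator "l2 G c r" "l2_norm G c r" T M
  by (intro bounded_operator.intro bounded_operator_axioms.intro l2.normed_subspace_axioms
      T_linear T_l2 T_le)

lemma subspace_cochains0: "subspace (cochains0 G)"
proof -
  have fin: "finite {x. (f + g) x \<noteq> 0}" "finite {x. (a *\<^sub>R f) x \<noteq> 0}"
    if "finite {x. f x \<noteq> 0}" "finite {x. g x \<noteq> 0}" for f g :: "'b \<Rightarrow> real" and a
    by (rule finite_subset[of _ "{x. f x \<noteq> 0} \<union> {x. g x \<noteq> 0}"]; use that in auto)+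
  have supp: "cochains0 G = {u \<in> cochains G. finite {x. fst u x \<noteq> 0} \<and> finite {e. snd u e \<noteq> 0}}"
    unfolding cochains0_def cochains_def vfuns0_def efuns0_def vfuns_def efuns_def by fastforce
  show ?thesis
    unfolding supp
    by (rule subspaceI)
      (auto simp: fin subspace_0[OF subspace_cochains] subspace_add[OF subspace_cochains] subspace_scale[OF subspace_cochains]
        simp del: plus_fun_apply scaleR_fun_apply)
qed

definition away :: "'v pair_pre_digraph \<Rightarrow> 'v set \<Rightarrow> 'v cochain set" where
  "away G K = vfuns0 G (pverts G - K) \<times> efuns0 G (parcs G - arcs (with_proj G \<restriction> K))"

definition coords_on :: "'v set \<Rightarrow> ('v + 'v \<times> 'v) set" where
  "coords_on K = K <+> (K \<times> K)"

lemma ball_coords_on: "(\<forall>s\<in>coords_on K. P s) \<longleftrightarrow> (\<forall>x\<in>K. P (Inl x)) \<and> (\<forall>e\<in>K \<times> K. P (Inr e))"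
  by (auto simp: coords_on_def Plus_def)

text \<open>An edge lies outside of \<open>G\<^sub>K\<close> unless both its ends lie in \<open>K\<close>, so the support condition says that
  finitely many coordinates vanish when \<open>K\<close> is finite.\<close>

lemma away_eq: "away G K = {u \<in> cochains0 G. \<forall>s\<in>coords_on K. coord s u = 0}"
proof -
  have E: "arcs (with_proj G \<restriction> K) = parcs G \<inter> K \<times> K"
    by auto
  have "vfuns0 G (pverts G - K) = {f \<in> vfuns0 G (pverts G). \<forall>x\<in>K. f x = 0}"
    unfolding vfuns0_def by blast
  moreover have "efuns0 G (parcs G - arcs (with_proj G \<restriction> K))
      = {\<phi> \<in> efuns0 G (parcs G). \<forall>e\<in>K \<times> K. \<phi> e = 0}"
    unfolding efuns0_def E by blast
  ultimately show ?thesis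
    unfolding away_def cochains0_def ball_coords_on by (auto simp del: split_paired_Ball_Sigma)
qed

lemma finite_coords_on: "finite K \<Longrightarrow> finite (coords_on K)"
  by (simp add: coords_on_def)

lemma subspace_vanishing: "subspace {u \<in> cochains0 G. \<forall>s\<in>I. coord s u = 0}"
proof -
  have "linear (coord s)" for s :: "'a + 'a \<times> 'a"
    by (intro linearI) (simp_all add: coord_add coord_scaleR)
  then have "subspace (\<Inter>s\<in>I. {u. coord s u = 0})"
    by (intro subspace_Inter) (auto intro: linear_subspace_kernel)
  then have "subspace (cochains0 G \<inter> (\<Inter>s\<in>I. {u. coord s u = 0}))"
    by (intro subspace_inter subspace_cochains0)
  moreover have "cochains0 G \<inter> (\<Inter>s\<in>I. {u. coord s u = 0}) = {u \<in> cochains0 G. \<forall>s\<in>I. coord s u = 0}"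
    by blast
  ultimately show ?thesis by simp
qed

definition cut :: "'v set \<Rightarrow> 'v cochain \<Rightarrow> 'v cochain" where
  "cut K u = ((\<lambda>x. if x \<in> K then fst u x else 0), (\<lambda>e. if e \<in> K \<times> K then snd u e else 0))"

lemma coord_cut: "coord s (cut K u) = (if s \<in> coords_on K then coord s u else 0)"
  by (cases s) (auto simp: cut_def coords_on_def)

lemma cut_in_cochains0:
  assumes "u \<in> cochains0 G"
  shows "cut K u \<in> cochains0 G"
proof -
  have "{x. fst (cut K u) x \<noteq> 0} \<subseteq> {x. fst u x \<noteq> 0}" "{e. snd (cut K u) e \<noteq> 0} \<subseteq> {e. snd u e \<noteq> 0}"
    by (auto simp: cut_def)
  moreover have "snd (cut K u) (prod.swap e) = - snd (cut K u) e" if "e \<in> parcs G" for e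
    using assms that by (cases e) (auto simp: cut_def cochains0_def efuns0_def efuns_def)
  ultimately show ?thesis
    using assms unfolding cochains0_def vfuns0_def efuns0_def vfuns_def efuns_def mem_Times_iff
    by (blast intro: finite_subset)
qed

context gauss_bonnet_extension
begin

lemma \<iota>_add: "u \<in> cochains0 G \<Longrightarrow> v \<in> cochains0 G \<Longrightarrow> \<iota> (u + v) = \<iota> u + \<iota> v"
  and \<iota>_scaleR: "u \<in> cochains0 G \<Longrightarrow> \<iota> (a *\<^sub>R u) = a *\<^sub>R \<iota> u"
  and dense: "closure (\<iota> ` cochains0 G) = UNIV"
  using \<iota>_dense by (auto simp: dense_subspace_via_def)

text \<open>On the dense subspace \<open>j\<close> inverts the linear map \<open>\<iota>\<close>, and linearity is a closed condition.\<close>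

lemma linear_coord_j: "linear (\<lambda>w. coord s (j w))"
proof -
  let ?h = "\<lambda>w. coord s (j w)"
  let ?D = "\<iota> ` cochains0 G"
  have cont: "continuous_on UNIV ?h"
    using continuous_on_compose[OF cont_j continuous_on_subset[OF continuous_coord]] by (simp add: o_def)
  have cont': "continuous_on S (\<lambda>x. ?h (g x))" if "continuous_on S g" for S :: "'x::topological_space set" and g
    using continuous_on_compose2[OF cont that] by simp
  have "closure (?D \<times> ?D) \<subseteq> {z. ?h (fst z + snd z) = ?h (fst z) + ?h (snd z)}"
  proof (rule closure_minimal)
    show "?D \<times> ?D \<subseteq> {z. ?h (fst z + snd z) = ?h (fst z) + ?h (snd z)}"
    proof (intro subsetI CollectI, elim SigmaE imageE, hypsubst)
      fix u v assume u: "u \<in> cochains0 G" and v: "v \<in> cochains0 G"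
      show "?h (fst (\<iota> u, \<iota> v) + snd (\<iota> u, \<iota> v)) = ?h (fst (\<iota> u, \<iota> v)) + ?h (snd (\<iota> u, \<iota> v))"
        using j_\<iota>[OF subspace_add[OF subspace_cochains0 u v]]
        by (simp add: u v j_\<iota> coord_add flip: \<iota>_add)
    qed
    show "closed {z. ?h (fst z + snd z) = ?h (fst z) + ?h (snd z)}"
      by (intro closed_Collect_eq continuous_intros cont')
  qed
  then have add: "?h (v + w) = ?h v + ?h w" for v w
  proof -
    have "(v, w) \<in> closure (?D \<times> ?D)" by (simp add: closure_Times dense)
    with \<open>closure (?D \<times> ?D) \<subseteq> _\<close> show ?thesis by auto
  qed
  have "closure ?D \<subseteq> {w. ?h (a *\<^sub>R w) = a * ?h w}" for a
  proof (rule closure_minimal)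
    show "?D \<subseteq> {w. ?h (a *\<^sub>R w) = a * ?h w}"
    proof (intro subsetI CollectI, elim imageE, hypsubst)
      fix u assume u: "u \<in> cochains0 G"
      show "?h (a *\<^sub>R \<iota> u) = a * ?h (\<iota> u)"
        using j_\<iota>[OF subspace_scale[OF subspace_cochains0 u, of a]]
        by (simp add: u j_\<iota> coord_scaleR flip: \<iota>_scaleR)
    qed
    show "closed {w. ?h (a *\<^sub>R w) = a * ?h w}"
      by (intro closed_Collect_eq continuous_intros cont')
  qed
  then have "?h (a *\<^sub>R w) = a * ?h w" for a w
    using dense by auto
  with add show ?thesis by (intro linearI) auto
qed

lemma bounded_linear_coord_j: "bounded_linear (\<lambda>w. coord s (j w))"
  by (rule bounded_linear_of_continuous[OF linear_coord_j])
    (use continuous_on_compose[OF cont_j continuous_on_subset[OF continuous_coord]] in \<open>simp add: o_def\<close>)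

lemma eq_0_of_coord_j:
  assumes "\<And>s. coord s (j w) = 0"
  shows "w = 0"
proof -
  have "j w = j 0"
    using assms linear_0[OF linear_coord_j] by (intro coord_eqI) simp
  then show ?thesis using inj_j by (simp add: inj_eq)
qed

lemma subspace_\<iota>_image:
  assumes "subspace S" "S \<subseteq> cochains0 G"
  shows "subspace (\<iota> ` S)"
  unfolding subspace_def
proof (intro conjI allI ballI)
  have "\<iota> 0 = 0" using \<iota>_scaleR[of 0 0, OF subspace_0[OF subspace_cochains0]] by simp
  then show "0 \<in> \<iota> ` S" using subspace_0[OF assms(1)] by force
next
  fix v w assume "v \<in> \<iota> ` S" "w \<in> \<iota> ` S"
  then show "v + w \<in> \<iota> ` S"
    using \<iota>_add subspace_add[OF assms(1)] assms(2) by (auto simp flip: \<iota>_add simp: subset_iff)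
next
  fix a v assume "v \<in> \<iota> ` S"
  then show "a *\<^sub>R v \<in> \<iota> ` S"
    using subspace_scale[OF assms(1)] assms(2) by (auto simp flip: \<iota>_scaleR simp: subset_iff)
qed

text \<open>The coordinates separate the kernel of \<open>T\<close>, so finitely many of them recover each of its elements;
  \<open>K\<close> collects the vertices and edge ends that they involve. If \<open>u\<close> lives away from \<open>K\<close> and \<open>w\<close> is a
  preimage of \<open>T (\<iota> u)\<close> of controlled norm, then \<open>n = \<iota> u - w\<close> is in the kernel and has the same
  coordinates as \<open>- w\<close> there, so that \<open>n\<close>, and with it \<open>\<iota> u\<close>, is controlled by \<open>w\<close>.\<close>

lemma bound_away_of_semi_fredholm:
  assumes "semi_fredholm (l2_topology G c r) T"
  shows "\<exists>K C. K \<subseteq> pverts G \<and> finite K \<and> C > 0 \<and>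
    (\<forall>u\<in>away G K. C * norm (\<iota> u) \<le> l2_norm G c r (gauss_bonnet G c r u))"
proof -
  have closed: "closedin l2.mtopology (range T)"
    using assms by (simp add: semi_fredholm_def l2_topology_eq)
  obtain N where N: "finite N" "span N = {w. T w = 0}"
    using assms by (auto simp: semi_fredholm_def)
  obtain B where B: "B \<ge> 0" "\<And>y. y \<in> range T \<Longrightarrow> \<exists>w. T w = y \<and> norm w \<le> B * l2_norm G c r y"
    using T.bounded_preimage[OF l2_mcomplete closed] by blast
  obtain F e where F: "finite F" and e: "\<And>n. n \<in> span N \<Longrightarrow> n = (\<Sum>s\<in>F. coord s (j n) *\<^sub>R e s)"
    using coordinates_of_separating[of N UNIV "\<lambda>s w. coord s (j w)", OF N(1) linear_coord_j eq_0_of_coord_j]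
    by (metis UNIV_I)
  have "\<exists>k. \<forall>w. norm (coord s (j w)) \<le> norm w * k" for s
    using bounded_linear.bounded[OF bounded_linear_coord_j] by blast
  then obtain k where k: "\<And>s w. \<bar>coord s (j w)\<bar> \<le> norm w * k s"
    unfolding real_norm_def by metis
  define K where "K = pverts G \<inter> (\<Union>s\<in>F. case s of Inl x \<Rightarrow> {x} | Inr e \<Rightarrow> {fst e, snd e})"
  have K: "K \<subseteq> pverts G" "finite K"
    using F by (auto simp: K_def split: sum.split)
  have vanish: "coord s u = 0" if u: "u \<in> away G K" and "s \<in> F" for u s
  proof -
    have u0: "u \<in> cochains G" and on_K: "\<And>s. s \<in> coords_on K \<Longrightarrow> coord s u = 0"
      using u unfolding away_eq cochains0_def cochains_def vfuns0_def efuns0_def by auto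
    show ?thesis
    proof (cases s)
      case (Inl x)
      then have "x \<in> pverts G \<Longrightarrow> s \<in> coords_on K"
        using \<open>s \<in> F\<close> by (force simp: K_def coords_on_def)
      then show ?thesis using on_K coord_eq_0_outside(1)[OF u0, of x] Inl by blast
    next
      case (Inr e)
      have "s \<in> coords_on K" if "e \<in> parcs G"
      proof -
        have "fst e \<in> K" "snd e \<in> K"
          using \<open>s \<in> F\<close> Inr that by (force simp: K_def dest: in_arcsD1 in_arcsD2)+
        then show ?thesis using Inr by (cases e) (auto simp: coords_on_def)
      qed
      then show ?thesis using on_K coord_eq_0_outside(2)[OF u0, of e] Inr by blast
    qed
  qed
  \<comment> \<open>The summand 1 makes \<open>A\<close> positive even if \<open>B = 0\<close>.\<close>
  define A where "A = (1 + (\<Sum>s\<in>F. k s * norm (e s))) * B + 1"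
  \<comment> \<open>In the trivial space \<open>k s\<close> is arbitrary, so its sign is known only when a nonzero vector exists.\<close>
  have k_nonneg: "k s \<ge> 0" if "e s \<noteq> 0" for s
    using k[of s "e s"] that by (metis abs_ge_zero order_trans zero_le_mult_iff zero_less_norm_iff not_less)
  have sum_nonneg: "(\<Sum>s\<in>F. k s * norm (e s)) \<ge> 0"
    using k_nonneg by (intro sum_nonneg) (metis mult_nonneg_nonneg mult_zero_right norm_ge_zero norm_zero order_refl)
  then have "A > 0"
    using B(1) by (simp add: A_def add_nonneg_pos)
  have "norm (\<iota> u) \<le> A * l2_norm G c r (gauss_bonnet G c r u)" if u: "u \<in> away G K" for u
  proof -
    have u0: "u \<in> cochains0 G" using u by (simp add: away_eq)
    obtain w where w: "T w = T (\<iota> u)" "norm w \<le> B * l2_norm G c r (T (\<iota> u))"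
      using B(2) by blast
    define n where "n = \<iota> u - w"
    have "n \<in> span N"
      using w(1) by (simp add: N(2) n_def linear_diff[OF T_linear])
    have "\<bar>coord s (j n)\<bar> \<le> norm w * k s" if "s \<in> F" for s
    proof -
      have "coord s (j n) = - coord s (j w)"
        using vanish[OF u that] u0 by (simp add: n_def linear_diff[OF linear_coord_j] j_\<iota>)
      then show ?thesis using k by simp
    qed
    then have "norm (\<Sum>s\<in>F. coord s (j n) *\<^sub>R e s) \<le> (\<Sum>s\<in>F. norm w * k s * norm (e s))"
      by (intro sum_norm_le) (auto intro: mult_right_mono)
    then have "norm n \<le> norm w * (\<Sum>s\<in>F. k s * norm (e s))"
      using e[OF \<open>n \<in> span N\<close>] by (simp add: sum_distrib_left mult.assoc)
    moreover have "norm (\<iota> u) \<le> norm w + norm n"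
      using norm_triangle_ineq[of w n] by (simp add: n_def)
    ultimately have "norm (\<iota> u) \<le> norm w * (1 + (\<Sum>s\<in>F. k s * norm (e s)))"
      by (simp add: algebra_simps)
    also have "\<dots> \<le> (B * l2_norm G c r (T (\<iota> u))) * (1 + (\<Sum>s\<in>F. k s * norm (e s)))"
      using w(2) sum_nonneg by (intro mult_right_mono) auto
    also have "\<dots> \<le> A * l2_norm G c r (T (\<iota> u))"
      using l2_norm_nonneg by (simp add: A_def algebra_simps)
    finally show ?thesis by (simp add: T_\<iota> u0)
  qed
  then have "1 / A * norm (\<iota> u) \<le> l2_norm G c r (gauss_bonnet G c r u)" if "u \<in> away G K" for u
    using that \<open>A > 0\<close> by (simp add: field_simps)
  with K \<open>A > 0\<close> show ?thesis
    by (intro exI[of _ K] exI[of _ "1 / A"]) auto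
qed

text \<open>Let \<open>S\<close> be the closure of the cochains away from \<open>K\<close>, where the estimate persists, and \<open>N\<close> the
  finite-dimensional space of cochains living on \<open>G\<^sub>K\<close>. Reading off the coordinates on \<open>G\<^sub>K\<close> gives a
  continuous projection \<open>P\<close> onto \<open>N\<close>; cutting a finitely supported cochain in two shows \<open>w - P w \<in> S\<close> on
  a dense set, hence everywhere. So the range of \<open>T\<close> is \<open>T S + T N\<close>, a closed space plus a
  finite-dimensional one, and a kernel element without coordinates on \<open>G\<^sub>K\<close> lies in \<open>S\<close> and vanishes.\<close>

lemma semi_fredholm_of_bound_away:
  assumes "finite K" "C > 0"
    and bound: "\<And>u. u \<in> away G K \<Longrightarrow> C * norm (\<iota> u) \<le> l2_norm G c r (gauss_bonnet G c r u)"
  shows "semi_fredholm (l2_topology G c r) T"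
proof -
  define S where "S = closure (\<iota> ` away G K)"
  have away_sub: "subspace (away G K)" "away G K \<subseteq> cochains0 G"
    unfolding away_eq using subspace_vanishing by auto
  have S: "closed S" "subspace S"
    unfolding S_def using subspace_\<iota>_image[OF away_sub] by (auto intro: subspace_closure)
  have "S \<subseteq> {w. C * norm w \<le> l2_norm G c r (T w)}"
    unfolding S_def
  proof (rule closure_minimal)
    show "\<iota> ` away G K \<subseteq> {w. C * norm w \<le> l2_norm G c r (T w)}"
      using bound away_sub(2) T_\<iota> by fastforce
    show "closed {w. C * norm w \<le> l2_norm G c r (T w)}"
      by (intro closed_Collect_le continuous_intros T.continuous_p_T)
  qed
  then have below: "\<And>w. w \<in> S \<Longrightarrow> C * norm w \<le> l2_norm G c r (T w)" by blast
  define N where "N = \<iota> ` {u \<in> cochains0 G. \<forall>s\<in>- coords_on K. coord s u = 0}"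
  have "subspace N"
    unfolding N_def by (intro subspace_\<iota>_image subspace_vanishing) auto
  have N_sep: "n = 0" if "n \<in> N" "\<And>s. s \<in> coords_on K \<Longrightarrow> coord s (j n) = 0" for n
  proof (rule eq_0_of_coord_j)
    show "coord s (j n) = 0" for s
      using that j_\<iota> by (cases "s \<in> coords_on K") (auto simp: N_def)
  qed
  obtain B where B: "finite B" "span B = N"
    using finite_dim_of_separating[where h = "\<lambda>s w. coord s (j w)",
        OF finite_coords_on[OF \<open>finite K\<close>] linear_coord_j \<open>subspace N\<close> N_sep] by metis
  have "\<exists>F e. finite F \<and> F \<subseteq> coords_on K \<and> range e \<subseteq> N \<and>
      (\<forall>n\<in>N. n = (\<Sum>s\<in>F. coord s (j n) *\<^sub>R e s))"
    using coordinates_of_separating[where h = "\<lambda>s w. coord s (j w)",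
        OF B(1) linear_coord_j N_sep[folded B(2)]] unfolding B(2) .
  then obtain F e where F: "finite F" "F \<subseteq> coords_on K" and e_in: "range e \<subseteq> N"
    and "\<forall>n\<in>N. n = (\<Sum>s\<in>F. coord s (j n) *\<^sub>R e s)"
    by (elim exE conjE)
  then have e: "\<And>n. n \<in> N \<Longrightarrow> n = (\<Sum>s\<in>F. coord s (j n) *\<^sub>R e s)" by (elim bspec)
  define P where "P = (\<lambda>w. \<Sum>s\<in>F. coord s (j w) *\<^sub>R e s)"
  have P_in: "P w \<in> N" for w
    unfolding P_def using e_in \<open>subspace N\<close> by (intro subspace_sum subspace_scale) auto
  have cont_P: "continuous_on UNIV P"
    unfolding P_def
    by (intro continuous_intros linear_continuous_on bounded_linear_coord_j)
  have "closure (\<iota> ` cochains0 G) \<subseteq> (\<lambda>w. w - P w) -` S"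
  proof (rule closure_minimal)
    show "closed ((\<lambda>w. w - P w) -` S)"
      by (intro closed_vimage S continuous_intros cont_P)
    show "\<iota> ` cochains0 G \<subseteq> (\<lambda>w. w - P w) -` S"
    proof (intro subsetI, elim imageE, hypsubst)
      fix u assume u: "u \<in> cochains0 G"
      have cut: "cut K u \<in> cochains0 G" using cut_in_cochains0[OF u] .
      have rest: "u - cut K u \<in> away G K"
        using subspace_diff[OF subspace_cochains0 u cut] by (simp add: away_eq coord_diff coord_cut)
      have "\<iota> (cut K u) \<in> N"
        using cut by (auto simp: N_def coord_cut)
      then have "\<iota> (cut K u) = (\<Sum>s\<in>F. coord s (j (\<iota> (cut K u))) *\<^sub>R e s)"
        by (rule e)
      also have "\<dots> = P (\<iota> u)"
        unfolding P_def using F(2) by (intro sum.cong) (auto simp: j_\<iota> u cut coord_cut)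
      finally have "\<iota> u - P (\<iota> u) = \<iota> (u - cut K u)"
        using \<iota>_add[OF subsetD[OF away_sub(2) rest] cut] by (simp add: algebra_simps)
      then show "\<iota> u \<in> (\<lambda>w. w - P w) -` S"
        using rest closure_subset[of "\<iota> ` away G K"] by (auto simp: S_def)
    qed
  qed
  then have diff_in: "w - P w \<in> S" for w
    using dense by auto
  have "range T = {z + v | z v. z \<in> T ` S \<and> v \<in> span (T ` B)}"
  proof (intro equalityI subsetI)
    fix y assume "y \<in> range T"
    then obtain w where "y = T w" by blast
    then have "y = T (w - P w) + T (P w)" by (simp add: linear_diff[OF T_linear])
    moreover have "T (P w) \<in> span (T ` B)"
      using P_in B(2) by (simp add: linear_span_image[OF T_linear])
    ultimately show "y \<in> {z + v | z v. z \<in> T ` S \<and> v \<in> span (T ` B)}"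
      using diff_in by blast
  next
    fix y assume "y \<in> {z + v | z v. z \<in> T ` S \<and> v \<in> span (T ` B)}"
    then obtain z v where "y = z + v" "z \<in> T ` S" "v \<in> T ` span B"
      unfolding linear_span_image[OF T_linear] by blast
    then obtain w b where "y = T w + T b" by blast
    then have "y = T (w + b)" by (simp add: linear_add[OF T_linear])
    then show "y \<in> range T" by blast
  qed
  moreover have "closedin l2.mtopology {z + v | z v. z \<in> T ` S \<and> v \<in> span (T ` B)}"
    using T.closedin_image_of_bounded_below[OF S \<open>C > 0\<close> below] linear_subspace_image[OF T_linear S(2)]
      B(1) T_l2 by (intro l2.closedin_add_span) auto
  ultimately have "closedin (l2_topology G c r) (range T)"
    by (simp add: l2_topology_eq)
  moreover have "w = 0" if "w \<in> {w. T w = 0}" "\<And>s. s \<in> coords_on K \<Longrightarrow> coord s (j w) = 0" for w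
  proof -
    have "P w = 0" unfolding P_def using that(2) F(2) by (intro sum.neutral) auto
    then have "C * norm w \<le> 0"
      using below[OF diff_in[of w]] that(1) l2.p_0 by simp
    then show ?thesis using \<open>C > 0\<close> by (simp add: mult_le_0_iff)
  qed
  then have "\<exists>B. finite B \<and> span B = {w. T w = 0}"
    by (rule finite_dim_of_separating[where h = "\<lambda>s w. coord s (j w)",
        OF finite_coords_on[OF \<open>finite K\<close>] linear_coord_j linear_subspace_kernel[OF T_linear]])
  ultimately show ?thesis by (simp add: semi_fredholm_def)
qed

end

section \<open>The semi-Fredholm criterion\<close>

theorem mainTheorem1:
  fixes G :: "'v pair_pre_digraph"
    and c :: "'v \<Rightarrow> real"
    and r :: "'v \<times> 'v \<Rightarrow> real"
    and \<iota> :: "'v cochain \<Rightarrow> 'w::{real_inner, complete_space}"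
    and D\<^sub>W :: "'w \<Rightarrow> 'v cochain"
  assumes "weighted_graph G c r"
    and "locally_finite G"
    and "Digraph_Component.connected (with_proj G)"
    and "dense_subspace_via G \<iota>"
    and "injection_extends G \<iota>"
    and "bounded_extension G c r \<iota> D\<^sub>W"
  shows "semi_fredholm (l2_topology G c r) D\<^sub>W \<longleftrightarrow>
    (\<exists>K C. K \<subseteq> pverts G \<and> finite K \<and> C > 0 \<and>
       (\<forall>f\<in>vfuns0 G (pverts G - K). \<forall>\<phi>\<in>efuns0 G (parcs G - arcs (with_proj G \<restriction> K)).
          C * norm (\<iota> (f, \<phi>)) \<le> l2_norm G c r (gauss_bonnet G c r (f, \<phi>))))"
proof -
  obtain j :: "'w \<Rightarrow> 'v cochain" where j: "continuous_on UNIV j" "inj j" "range j \<subseteq> cochains G"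
    "\<And>u. u \<in> cochains0 G \<Longrightarrow> j (\<iota> u) = u"
    using \<open>injection_extends G \<iota>\<close> unfolding injection_extends_def by blast
  obtain M where M: "\<And>w. l2_norm G c r (D\<^sub>W w) \<le> M * norm w"
    using \<open>bounded_extension G c r \<iota> D\<^sub>W\<close> unfolding bounded_extension_def by blast
  interpret weighted_graph G c r by fact
  interpret gauss_bonnet_extension G c r \<iota> D\<^sub>W j M
  proof (intro gauss_bonnet_extension.intro gauss_bonnet_extension_axioms.intro)
    show "j w \<in> cochains G" for w using j(3) by blast
    have D: "linear D\<^sub>W" "range D\<^sub>W \<subseteq> l2 G c r" "\<forall>u\<in>cochains0 G. D\<^sub>W (\<iota> u) = gauss_bonnet G c r u"
      using assms(6) by (simp_all add: bounded_extension_def)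
    show "linear D\<^sub>W" by fact
    show "D\<^sub>W w \<in> l2 G c r" for w using D(2) by blast
    show "D\<^sub>W (\<iota> u) = gauss_bonnet G c r u" if "u \<in> cochains0 G" for u using D(3) that by blast
  qed (fact weighted_graph_axioms assms(4) j M)+
  have "semi_fredholm (l2_topology G c r) D\<^sub>W \<longleftrightarrow>
    (\<exists>K C. K \<subseteq> pverts G \<and> finite K \<and> C > 0 \<and>
       (\<forall>u\<in>away G K. C * norm (\<iota> u) \<le> l2_norm G c r (gauss_bonnet G c r u)))"
    using bound_away_of_semi_fredholm semi_fredholm_of_bound_away by blast
  then show ?thesis
    unfolding away_def split_paired_Ball_Sigma .
qed

end
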